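(* Let $p$ be an odd prime, $c\in\mathbb Z_p$ with $c(c^2+1)\not\equiv 0\pmod p$. Then $$\Big(\frac 2p\Big)\sum_{k=0}^{[p/4]}\binom{4k}{2k}\Big(\frac{c^2}{16(c^2+1)}\Big)^k\equiv\begin{cases}1\pmod p&\text{if } c\in Q_0(p),\\ c\pmod p&\text{if } c\in Q_1(p),\\ -1\pmod p&\text{if } c\in Q_2(p),\\ -c\pmod p&\text{if } c\in Q_3(p),\end{cases}$$ and $$\sum_{k=0}^{[p/4]}\binom{4k}{2k}\frac{1}{(16(c^2+1))^k}\equiv\begin{cases}1\pmod p&\text{if } c\in Q_0(p),\\ -\frac1c\pmod p&\text{if } c\in Q_1(p),\\ -1\pmod p&\text{if } c\in Q_2(p),\\ \frac1c\pmod p&\text{if } c\in Q_3(p).\end{cases}$$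
   Context: $[x]$ is the greatest integer $\le x$; $\mathbb Z_p$ is the set of rational numbers whose denominator is not divisible by $p$; $(\frac{\cdot}{p})$ is the Legendre symbol; $i=\sqrt{-1}$. Quartic Jacobi symbol: for a Gaussian prime $\pi\nmid 2$ and a Gaussian integer $\alpha$, $(\frac{\alpha}{\pi})_4$ is the unique element of $\{0,1,i,-1,-i\}$ congruent to $\alpha^{(N\pi-1)/4}$ modulo $\pi$. For an odd rational prime $p$, $(\frac{\alpha}{p})_4=\prod_j(\frac{\alpha}{\pi_j})_4$ where $p=\prod_j\pi_j$ is the factorization into Gaussian primes (so $(\frac\alpha p)_4$ with $p$ itself if $p\equiv3\pmod 4$, and $(\frac\alpha\pi)_4(\frac\alpha{\bar\pi})_4$ if $p=\pi\bar\pi\equiv1\pmod4$). For $m,n\in\mathbb Z_p$, $(\frac{m+ni}{p})_4$ is defined as $(\frac{\alpha}{p})_4$ for any Gaussian integer $\alpha\equiv m+ni\pmod p$ (this is well defined). For $r=0,1,2,3$, $Q_r(p)=\{c\in\mathbb Z_p:(\frac{c+i}{p})_4=i^r\}$. *)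

theory Defs
  imports Complex_Main "HOL-Number_Theory.Quadratic_Reciprocity"
begin

definition gauss_int :: "complex \<Rightarrow> bool" where
  "gauss_int z \<longleftrightarrow> Re z \<in> \<int> \<and> Im z \<in> \<int>"

definition gdvd :: "complex \<Rightarrow> complex \<Rightarrow> bool" where
  "gdvd a b \<longleftrightarrow> (\<exists>k. gauss_int k \<and> b = a * k)"

definition gcong :: "complex \<Rightarrow> complex \<Rightarrow> complex \<Rightarrow> bool" where
  "gcong a b m \<longleftrightarrow> gdvd m (a - b)"

definition gauss_prime :: "complex \<Rightarrow> bool" where
  "gauss_prime q \<longleftrightarrow> gauss_int q \<and> q \<noteq> 0 \<and> \<not> gdvd q 1 \<and>
     (\<forall>a b. gauss_int a \<longrightarrow> gauss_int b \<longrightarrow> gdvd q (a * b) \<longrightarrow> gdvd q a \<or> gdvd q b)"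

definition gnorm :: "complex \<Rightarrow> nat" where
  "gnorm q = nat \<lfloor>(Re q)^2 + (Im q)^2\<rfloor>"

text \<open>quartic residue symbol (alpha/q)_4 for a Gaussian prime q not dividing 2\<close>
definition qsym4 :: "complex \<Rightarrow> complex \<Rightarrow> complex" where
  "qsym4 \<alpha> q = (THE v. v \<in> {0, 1, \<i>, -1, -\<i>} \<and> gcong (\<alpha> ^ ((gnorm q - 1) div 4)) v q)"

text \<open>quartic Jacobi symbol (alpha/p)_4 for an odd rational prime p\<close>
definition qsym4_p :: "complex \<Rightarrow> nat \<Rightarrow> complex" where
  "qsym4_p \<alpha> p =
     (if gauss_prime (of_nat p) then qsym4 \<alpha> (of_nat p)
      else (let q = (SOME q. gauss_prime q \<and> of_nat p = q * cnj q)
            in qsym4 \<alpha> q * qsym4 \<alpha> (cnj q)))"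

definition in_Zp :: "nat \<Rightarrow> rat \<Rightarrow> bool" where
  "in_Zp p x \<longleftrightarrow> \<not> (int p dvd snd (quotient_of x))"

definition zp_cong :: "nat \<Rightarrow> rat \<Rightarrow> rat \<Rightarrow> bool" where
  "zp_cong p a b \<longleftrightarrow> in_Zp p ((a - b) / of_nat p)"

definition qsym4_Zp :: "nat \<Rightarrow> rat \<Rightarrow> rat \<Rightarrow> complex" where
  "qsym4_Zp p m n =
     (let (a, b) = (SOME (a, b). zp_cong p (of_int a) m \<and> zp_cong p (of_int b) n)
      in qsym4_p (of_int a + of_int b * \<i>) p)"

definition Qr :: "nat \<Rightarrow> nat \<Rightarrow> rat set" where
  "Qr r p = {c. in_Zp p c \<and> qsym4_Zp p c 1 = \<i> ^ r}"

end

(* With n = (p-1)/2 one has C(2j,j) == (-4)^j C(n,j) (mod p), so both sums are even parts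
   (1/2)((1+t)^n + (1-t)^n) with t^2 = c^2/(c^2+1) or t^2 = 1/(c^2+1).  Put alpha = c + i and
   choose square roots beta, beta' of alpha and its conjugate, s = beta beta'.  Then
   2(s + c) = (beta + beta')^2 and 2(s - c) = -(beta - beta')^2, so expanding the 2n = (p-1)-st
   powers, where C(p-1,l) == (-1)^l, gives a geometric sum in alpha and its conjugate.  It is
   evaluated by the congruence alpha^((p-1)/4) == i^r conj(alpha)^((p-1)/4) modulo a Gaussian
   prime divisor of p (p == 1 mod 4), or its Frobenius-twisted analogue modulo p (p == 3 mod 4),
   which is what c in Q_r(p) means.  The second sum arises from the first one by
   exchanging real and imaginary part of alpha. *)
theory Submission
  imports Defs
begin

section \<open>Divisibility and congruences of Gaussian integers\<close>

text \<open>Three points shape the statements. The symbol of c + i is read off from integer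
  representatives \<open>a + b i\<close> picked by \<open>SOME\<close>, with \<open>b\<close> merely
  congruent to 1. So everything is proved for a general x + y i, with sums homogenized in x and N =
  x^2 + y^2; the factors y and x in the two resulting congruences are absorbed at the end by b == 1
  and a == c. If p == 1 (mod 4), the symbol gives a relation modulo a single Gaussian prime q above
  p, while the binomial expansions hold modulo p. Working modulo q suffices, since a rational
  integer divisible by q is divisible by p. The expansions always carry a factor 2^n. In the first
  sum it is (2/p) by Euler's criterion. In the second, replacing \<alpha> by i times its conjugate
  creates the sign (-1)^[(p+1)/4], which is itself congruent to 2^n, so both disappear.\<close>

lemma gauss_int_of_int [simp]: "gauss_int (of_int n)"
  by (simp add: gauss_int_def)

lemma gauss_int_of_nat [simp]: "gauss_int (of_nat n)"
  by (simp add: gauss_int_def)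

lemma gauss_int_numeral [simp]: "gauss_int 0" "gauss_int 1" "gauss_int (numeral k)" "gauss_int \<i>"
  by (simp_all add: gauss_int_def)

lemma gauss_int_add [simp]: "gauss_int a \<Longrightarrow> gauss_int b \<Longrightarrow> gauss_int (a + b)"
  by (simp add: gauss_int_def)

lemma gauss_int_minus [simp]: "gauss_int (- a) \<longleftrightarrow> gauss_int a"
  by (simp add: gauss_int_def)

lemma gauss_int_diff [simp]: "gauss_int a \<Longrightarrow> gauss_int b \<Longrightarrow> gauss_int (a - b)"
  by (simp add: gauss_int_def)

lemma gauss_int_mult [simp]: "gauss_int a \<Longrightarrow> gauss_int b \<Longrightarrow> gauss_int (a * b)"
  by (simp add: gauss_int_def)

lemma gauss_int_power [simp]: "gauss_int a \<Longrightarrow> gauss_int (a ^ n)"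
  by (induction n) auto

lemma gauss_int_cnj [simp]: "gauss_int (cnj a) \<longleftrightarrow> gauss_int a"
  by (simp add: gauss_int_def)

lemma gauss_intE:
  assumes "gauss_int z"
  obtains a b :: int where "z = of_int a + of_int b * \<i>"
proof -
  from assms obtain a b where "Re z = of_int a" "Im z = of_int b"
    by (auto simp: gauss_int_def elim!: Ints_cases)
  then show ?thesis by (intro that[of a b]) (simp add: complex_eq_iff)
qed

lemma of_int_plus_ii_eq_iff:
  "(of_int a + of_int b * \<i> = of_int c + of_int d * \<i>) \<longleftrightarrow> a = c \<and> b = d"
  by (simp add: complex_eq_iff)

lemma gdvd_0 [simp]: "gdvd m 0"
  unfolding gdvd_def by (rule exI[of _ 0]) simp

lemma gdvd_triv [simp]: "gauss_int b \<Longrightarrow> gdvd a (a * b)"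
  by (auto simp: gdvd_def)

lemma gdvd_add: "gdvd m a \<Longrightarrow> gdvd m b \<Longrightarrow> gdvd m (a + b)"
  unfolding gdvd_def by (metis gauss_int_add distrib_left)

lemma gdvd_minus: "gdvd m a \<Longrightarrow> gdvd m (- a)"
  unfolding gdvd_def by (metis gauss_int_minus mult_minus_right)

lemma gdvd_diff: "gdvd m a \<Longrightarrow> gdvd m b \<Longrightarrow> gdvd m (a - b)"
  using gdvd_add[of m a "- b"] gdvd_minus[of m b] by simp

lemma gdvd_mult: "gdvd m a \<Longrightarrow> gauss_int b \<Longrightarrow> gdvd m (a * b)"
  unfolding gdvd_def by (metis gauss_int_mult mult.assoc)

lemma gdvd_trans: "gdvd a b \<Longrightarrow> gdvd b c \<Longrightarrow> gdvd a c"
  unfolding gdvd_def by (metis gauss_int_mult mult.assoc)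

lemma gdvd_cnj: "gdvd (cnj m) (cnj a) \<longleftrightarrow> gdvd m a"
proof -
  have *: "gdvd (cnj m) (cnj a)" if "gdvd m a" for m a
    using that unfolding gdvd_def by (metis complex_cnj_mult gauss_int_cnj)
  show ?thesis using *[of m a] *[of "cnj m" "cnj a"] by auto
qed

lemma gdvd_of_int: "a dvd b \<Longrightarrow> gdvd (of_int a) (of_int b)"
  by (metis dvdE gauss_int_of_int gdvd_triv of_int_mult)

lemma gcong_refl [simp]: "gcong a a m"
  by (simp add: gcong_def)

lemma gcong_sym: "gcong a b m \<Longrightarrow> gcong b a m"
  unfolding gcong_def using gdvd_minus[of m "a - b"] by simp

lemma gcong_trans [trans]: "gcong a b m \<Longrightarrow> gcong b c m \<Longrightarrow> gcong a c m"
  unfolding gcong_def using gdvd_add[of m "a - b" "b - c"] by simp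

lemma gcong_add: "gcong a b m \<Longrightarrow> gcong c d m \<Longrightarrow> gcong (a + c) (b + d) m"
  unfolding gcong_def using gdvd_add[of m "a - b" "c - d"] by (simp add: algebra_simps)

lemma gcong_minus: "gcong a b m \<Longrightarrow> gcong (- a) (- b) m"
  unfolding gcong_def using gdvd_minus[of m "a - b"] by (simp add: algebra_simps)

lemma gcong_diff: "gcong a b m \<Longrightarrow> gcong c d m \<Longrightarrow> gcong (a - c) (b - d) m"
  using gcong_add[of a b m "- c" "- d"] gcong_minus[of c d m] by simp

lemma gcong_mult_left: "gcong a b m \<Longrightarrow> gauss_int c \<Longrightarrow> gcong (c * a) (c * b) m"
  unfolding gcong_def using gdvd_mult[of m "a - b" c] by (simp add: algebra_simps)

lemma gcong_mult:
  assumes "gcong a b m" "gcong c d m" "gauss_int c" "gauss_int b"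
  shows "gcong (a * c) (b * d) m"
proof -
  have "gcong (a * c) (b * c) m"
    using gcong_mult_left[OF assms(1,3)] by (simp add: mult.commute)
  also have "gcong (b * c) (b * d) m" by (rule gcong_mult_left[OF assms(2,4)])
  finally show ?thesis .
qed

lemma gcong_power:
  assumes "gcong a b m" "gauss_int a" "gauss_int b"
  shows "gcong (a ^ n) (b ^ n) m"
  by (induction n) (use assms in \<open>auto intro!: gcong_mult\<close>)

lemma gcong_sum: "(\<And>x. x \<in> A \<Longrightarrow> gcong (f x) (g x) m) \<Longrightarrow> gcong (sum f A) (sum g A) m"
  by (induction A rule: infinite_finite_induct) (auto intro!: gcong_add)

lemma gcong_cnj: "gcong (cnj a) (cnj b) (cnj m) \<longleftrightarrow> gcong a b m"
  unfolding gcong_def using gdvd_cnj[of m "a - b"] by simp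

lemma gcong_of_int: "[a = b] (mod m) \<Longrightarrow> gcong (of_int a) (of_int b) (of_int m)"
  unfolding gcong_def using gdvd_of_int[of m "a - b"] by (simp add: cong_iff_dvd_diff)

lemma gcong_modulus: "gcong a b m \<Longrightarrow> gdvd q m \<Longrightarrow> gcong a b q"
  unfolding gcong_def using gdvd_trans by blast

lemma gdvd_of_int_plus_ii_iff:
  "gdvd (of_int p) (of_int a + of_int b * \<i>) \<longleftrightarrow> p dvd a \<and> p dvd b"
proof
  assume "gdvd (of_int p) (of_int a + of_int b * \<i>)"
  then obtain k where k: "gauss_int k" "of_int a + of_int b * \<i> = of_int p * k"
    by (auto simp: gdvd_def)
  from k(1) obtain c d where "k = of_int c + of_int d * \<i>" by (rule gauss_intE)
  with k(2) have "of_int a + of_int b * \<i> = of_int (p * c) + of_int (p * d) * \<i>"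
    by (simp add: algebra_simps)
  then show "p dvd a \<and> p dvd b" by (simp only: of_int_plus_ii_eq_iff) simp
next
  assume "p dvd a \<and> p dvd b"
  then obtain c d where "a = p * c" "b = p * d" by (auto elim!: dvdE)
  then have "of_int a + of_int b * \<i> = of_int p * (of_int c + of_int d * \<i>)"
    by (simp add: algebra_simps)
  then show "gdvd (of_int p) (of_int a + of_int b * \<i>)" by simp
qed

lemma gdvd_of_int_iff: "gdvd (of_int p) (of_int a) \<longleftrightarrow> p dvd a"
  using gdvd_of_int_plus_ii_iff[of p a 0] by simp

section \<open>Norms, and Gaussian integers whose norm is a rational prime\<close>

lemma mult_cnj_of_int_plus_ii:
  "(of_int a + of_int b * \<i>) * cnj (of_int a + of_int b * \<i>) = of_int (a\<^sup>2 + b\<^sup>2)"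
  by (simp add: algebra_simps power2_eq_square complex_eq_iff)

lemma gdvd_norm:
  assumes "gdvd q z" "q * cnj q = of_int P" "z * cnj z = of_int N"
  shows "P dvd N"
proof -
  from assms(1) obtain k where k: "gauss_int k" "z = q * k" by (auto simp: gdvd_def)
  from k(1) obtain c d where "k = of_int c + of_int d * \<i>" by (rule gauss_intE)
  then have kk: "k * cnj k = of_int (c\<^sup>2 + d\<^sup>2)" using mult_cnj_of_int_plus_ii by simp
  have "of_int N = q * cnj q * (k * cnj k)"
    using assms(3) k(2) by (simp add: mult_ac)
  also have "\<dots> = of_int (P * (c\<^sup>2 + d\<^sup>2))"
    by (simp only: kk assms(2) of_int_mult)
  finally show ?thesis by (simp only: of_int_eq_iff) simp
qed

text \<open>Taking norms turns q | N into p | N^2. This is what allows a congruence between rational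
  integers modulo \<open>q\<close> to be read modulo \<open>p\<close>.\<close>

lemma gdvd_of_int_iff_of_norm:
  fixes q :: complex and p :: nat
  assumes "prime p" "gauss_int q" "q * cnj q = of_nat p"
  shows "gdvd q (of_int N) \<longleftrightarrow> int p dvd N"
proof
  assume "gdvd q (of_int N)"
  then have "int p dvd N * N" by (rule gdvd_norm) (use assms in auto)
  then show "int p dvd N" using assms(1) by (simp add: prime_dvd_mult_iff)
next
  assume "int p dvd N"
  moreover have "gdvd q (of_int (int p))" unfolding gdvd_def using assms by (metis gauss_int_cnj of_int_of_nat_eq)
  ultimately show "gdvd q (of_int N)" using gdvd_of_int gdvd_trans by blast
qed

text \<open>The residues modulo \<open>q\<close> are those of the rational integers modulo
  \<open>p\<close>: since i reduces to a rational integer, so does every Gaussian integer, and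
  primality of \<open>q\<close> becomes Euclid's lemma for \<open>p\<close>.\<close>

lemma gauss_prime_if_norm_prime:
  fixes q :: complex and p :: nat
  assumes p: "prime p" and q: "gauss_int q" "q * cnj q = of_nat p"
  shows "gauss_prime q"
proof -
  note iff = gdvd_of_int_iff_of_norm[OF p q]
  have qp: "gdvd q (of_int (int p))" by (subst iff) simp
  from q(1) obtain x y where xy: "q = of_int x + of_int y * \<i>" by (rule gauss_intE)
  then have "of_int (x\<^sup>2 + y\<^sup>2) = (of_int (int p) :: complex)"
    using mult_cnj_of_int_plus_ii[of x y] q(2) by simp
  then have sum: "x\<^sup>2 + y\<^sup>2 = int p" by (simp only: of_int_eq_iff)
  have p': "prime (int p)" using p by simp
  \<comment> \<open>If p divided y, it would divide x too, and p^2 would divide x^2 + y^2 = p. So y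
    is invertible modulo p, and x + y i == 0 can be solved for i modulo q.\<close>
  have "\<not> int p dvd y"
  proof
    assume y: "int p dvd y"
    then have "int p dvd y\<^sup>2" by (simp add: power2_eq_square)
    moreover have "x\<^sup>2 = int p - y\<^sup>2" using sum by simp
    ultimately have "int p dvd x\<^sup>2" by simp
    then have "int p dvd x" using p' prime_dvd_power by blast
    with y have "(int p)\<^sup>2 dvd x\<^sup>2 + y\<^sup>2" by (intro dvd_add) (simp_all add: dvd_power_same)
    then have "(int p)\<^sup>2 dvd int p * 1" by (simp only: sum mult_1_right)
    then have "int p * int p dvd int p * 1" by (simp only: power2_eq_square)
    then have "int p dvd 1" using p by (metis dvd_times_left_cancel_iff not_prime_0 of_nat_eq_0_iff)
    then show False using p' by (simp add: prime_int_iff zdvd1_eq)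
  qed
  then have "coprime y (int p)"
    using p' by (metis coprime_commute prime_imp_coprime)
  then obtain y' where y': "[y * y' = 1] (mod int p)"
    using cong_solve_coprime_int by blast
  \<comment> \<open>every Gaussian integer is congruent to a rational integer modulo q\<close>
  have i: "gcong \<i> (of_int (- x * y')) q"
  proof -
    have "gcong (of_int (y * y') * \<i>) (1 * \<i>) q"
      using gcong_mult_left[OF gcong_modulus[OF gcong_of_int[OF y'] qp], of \<i>] by (simp add: mult.commute)
    moreover have "gcong (q * of_int y') 0 q" using q by (simp add: gcong_def)
    ultimately have "gcong (q * of_int y' - of_int (y * y') * \<i>) (0 - 1 * \<i>) q"
      by (intro gcong_diff)
    then show ?thesis using gcong_minus[of _ "- \<i>" q] gcong_sym by (fastforce simp: xy algebra_simps)
  qed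
  have red: "\<exists>t. gcong a (of_int t) q" if "gauss_int a" for a
  proof -
    from that obtain c d where "a = of_int c + of_int d * \<i>" by (rule gauss_intE)
    then have "gcong a (of_int c + of_int d * of_int (- x * y')) q"
      using gcong_add[OF gcong_refl gcong_mult_left[OF i gauss_int_of_int]] by simp
    then show ?thesis by (metis of_int_add of_int_mult)
  qed
  have dvd_iff: "gdvd q a \<longleftrightarrow> gdvd q b" if "gcong a b q" for a b
    using gdvd_add[of q "a - b" b] gdvd_diff[of q a "a - b"] that by (auto simp: gcong_def)
  have "gdvd q a \<or> gdvd q b" if ab: "gauss_int a" "gauss_int b" "gdvd q (a * b)" for a b
  proof -
    obtain s t where st: "gcong a (of_int s) q" "gcong b (of_int t) q"
      using red ab(1,2) by blast
    then have "gcong (a * b) (of_int (s * t)) q"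
      using gcong_mult[OF st] ab(2) by simp
    then have "int p dvd s * t" using ab(3) dvd_iff iff by blast
    then have "int p dvd s \<or> int p dvd t" using p' by (simp add: prime_dvd_mult_iff)
    then show ?thesis using dvd_iff iff st by blast
  qed
  moreover have "\<not> gdvd q 1" using iff[of 1] p' by (auto simp: prime_int_iff zdvd1_eq)
  moreover have "q \<noteq> 0" using q(2) p by auto
  ultimately show ?thesis using q(1) by (auto simp: gauss_prime_def)
qed

section \<open>Binomial identities and congruences\<close>

lemma sum_atMost_double:
  "sum f {..2 * n} = (\<Sum>k\<le>n. f (2 * k)) + (\<Sum>k<n. f (Suc (2 * k)) :: 'a::comm_monoid_add)"
  by (induction n) (simp_all add: add_ac)

lemma sum_atMost_Suc_double:
  "sum f {..Suc (2 * n)} = (\<Sum>k\<le>n. f (2 * k)) + (\<Sum>k\<le>n. f (Suc (2 * k)) :: 'a::comm_monoid_add)"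
  by (induction n) (simp_all add: add_ac)

lemma power_add_plus_power_diff:
  fixes u v :: "'a::comm_ring_1"
  shows "(u + v) ^ N + (u - v) ^ N =
    2 * (\<Sum>k\<le>N div 2. of_nat (N choose (2 * k)) * v ^ (2 * k) * u ^ (N - 2 * k))"
proof -
  \<comment> \<open>Both expansions added termwise: odd indices cancel and even ones double. The
    parity of \<open>N\<close> only decides whether the last index is even or odd.\<close>
  define f where "f = (\<lambda>k. of_nat (N choose k) * (v ^ k + (- v) ^ k) * u ^ (N - k))"
  have "(u + v) ^ N + (u - v) ^ N = (v + u) ^ N + (- v + u) ^ N"
    by (simp add: add.commute)
  also have "\<dots> = sum f {..N}"
    unfolding binomial_ring f_def by (simp add: sum.distrib algebra_simps)
  also have "\<dots> = (\<Sum>k\<le>N div 2. f (2 * k))"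
  proof (cases "even N")
    case True
    then have "N = 2 * (N div 2)" by simp
    moreover have "sum f {..2 * (N div 2)} = (\<Sum>k\<le>N div 2. f (2 * k))"
      unfolding sum_atMost_double by (simp add: f_def)
    ultimately show ?thesis by simp
  next
    case False
    then have "N = Suc (2 * (N div 2))" by simp
    moreover have "sum f {..Suc (2 * (N div 2))} = (\<Sum>k\<le>N div 2. f (2 * k))"
      unfolding sum_atMost_Suc_double by (simp add: f_def)
    ultimately show ?thesis by simp
  qed
  also have "\<dots> = 2 * (\<Sum>k\<le>N div 2. of_nat (N choose (2 * k)) * v ^ (2 * k) * u ^ (N - 2 * k))"
    by (simp add: f_def sum_distrib_left algebra_simps)
  finally show ?thesis .
qed

lemma power_add_minus_power_diff:
  fixes u v :: "'a::comm_ring_1"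
  shows "(u + v) ^ (2 * n) - (u - v) ^ (2 * n) =
    2 * (\<Sum>k<n. of_nat ((2 * n) choose Suc (2 * k)) * v ^ Suc (2 * k) * u ^ (2 * n - Suc (2 * k)))"
proof -
  define f where "f = (\<lambda>k. of_nat ((2 * n) choose k) * (v ^ k - (- v) ^ k) * u ^ (2 * n - k))"
  have "(u + v) ^ (2 * n) - (u - v) ^ (2 * n) = (v + u) ^ (2 * n) - (- v + u) ^ (2 * n)"
    by (simp add: add.commute)
  also have "\<dots> = sum f {..2 * n}"
    unfolding binomial_ring f_def by (simp add: sum_subtractf algebra_simps)
  also have "\<dots> = 2 * (\<Sum>k<n. of_nat ((2 * n) choose Suc (2 * k)) * v ^ Suc (2 * k) * u ^ (2 * n - Suc (2 * k)))"
    unfolding sum_atMost_double by (simp add: f_def sum_distrib_left algebra_simps)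
  finally show ?thesis .
qed

text \<open>
  Both identities below come from
  \<open>2 (s + x) = (\<beta> + \<beta>')\<^sup>2\<close> and \<open>2 (s - x) = - (\<beta> - \<beta>')\<^sup>2\<close>, where
  \<open>\<beta>\<^sup>2 = \<alpha>\<close>, \<open>\<beta>'\<^sup>2 = \<gamma>\<close> and \<open>s = \<beta> \<beta>'\<close>.
\<close>

lemma even_binomial_identity:
  fixes \<alpha> \<gamma> x :: complex
  assumes "2 * x = \<alpha> + \<gamma>"
  shows "2 ^ (2 * m) * (\<Sum>k\<le>m. of_nat ((2 * m) choose (2 * k)) * x ^ (2 * k) * (\<alpha> * \<gamma>) ^ (m - k)) =
    (\<Sum>j\<le>2 * m. of_nat ((4 * m) choose (2 * j)) * \<alpha> ^ j * \<gamma> ^ (2 * m - j))"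
proof -
  define \<beta> \<beta>' where "\<beta> = csqrt \<alpha>" "\<beta>' = csqrt \<gamma>"
  then have sq: "\<beta>\<^sup>2 = \<alpha>" "\<beta>'\<^sup>2 = \<gamma>" by auto
  \<comment> \<open>The product of the chosen roots, not \<open>csqrt (\<alpha> * \<gamma>)\<close>,
    which may differ from it in sign; the signs in \<open>plus\<close> and \<open>minus\<close>
    refer to this product.\<close>
  define s where "s = \<beta>' * \<beta>"
  have s2: "s\<^sup>2 = \<alpha> * \<gamma>" by (simp add: s_def sq power_mult_distrib)
  have plus: "2 * (s + x) = (\<beta>' + \<beta>)\<^sup>2" and minus: "2 * (s - x) = - (\<beta>' - \<beta>)\<^sup>2"
    using assms by (simp_all add: s_def sq[symmetric] power2_eq_square algebra_simps)
  have "2 * (2 ^ (2 * m) * (\<Sum>k\<le>m. of_nat ((2 * m) choose (2 * k)) * x ^ (2 * k) * (\<alpha> * \<gamma>) ^ (m - k)))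
    = 2 ^ (2 * m) * (2 * (\<Sum>k\<le>2 * m div 2. of_nat ((2 * m) choose (2 * k)) * x ^ (2 * k) * s ^ (2 * m - 2 * k)))"
    by (simp add: s2[symmetric] power_mult[symmetric] diff_mult_distrib2)
  also have "\<dots> = (2 * (s + x)) ^ (2 * m) + (2 * (s - x)) ^ (2 * m)"
    unfolding power_add_plus_power_diff[symmetric] power_mult_distrib by (simp add: algebra_simps)
  also have "\<dots> = (\<beta>' + \<beta>) ^ (4 * m) + (\<beta>' - \<beta>) ^ (4 * m)"
    unfolding plus minus by (simp add: power_mult[symmetric])
  also have "\<dots> = 2 * (\<Sum>j\<le>2 * m. of_nat ((4 * m) choose (2 * j)) * \<beta> ^ (2 * j) * \<beta>' ^ (4 * m - 2 * j))"
    unfolding power_add_plus_power_diff by simp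
  also have "\<dots> = 2 * (\<Sum>j\<le>2 * m. of_nat ((4 * m) choose (2 * j)) * \<alpha> ^ j * \<gamma> ^ (2 * m - j))"
    by (simp add: sq[symmetric] power_mult[symmetric] diff_mult_distrib2)
  finally show ?thesis by simp
qed

lemma odd_binomial_identity:
  fixes \<alpha> \<gamma> x :: complex and m :: nat
  assumes "2 * x = \<alpha> + \<gamma>" "\<alpha> \<noteq> 0" "\<gamma> \<noteq> 0"
  defines "n \<equiv> Suc (2 * m)"
  shows "2 ^ n * (\<Sum>k\<le>m. of_nat (n choose (2 * k)) * x ^ (2 * k) * (\<alpha> * \<gamma>) ^ (m - k)) =
    (\<Sum>j<n. of_nat ((2 * n) choose Suc (2 * j)) * \<alpha> ^ j * \<gamma> ^ (2 * m - j))"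
proof -
  define \<beta> \<beta>' where "\<beta> = csqrt \<alpha>" "\<beta>' = csqrt \<gamma>"
  then have sq: "\<beta>\<^sup>2 = \<alpha>" "\<beta>'\<^sup>2 = \<gamma>" by auto
  define s where "s = \<beta>' * \<beta>"
  have s2: "s\<^sup>2 = \<alpha> * \<gamma>" by (simp add: s_def sq power_mult_distrib)
  then have s0: "s \<noteq> 0" using assms by auto
  have plus: "2 * (s + x) = (\<beta>' + \<beta>)\<^sup>2" and minus: "2 * (s - x) = - (\<beta>' - \<beta>)\<^sup>2"
    using assms by (simp_all add: s_def sq[symmetric] power2_eq_square algebra_simps)
  have n: "odd n" "n div 2 = m" by (simp_all add: n_def)
  \<comment> \<open>For odd \<open>n\<close> the expansion in \<open>s\<close> has odd exponents, so
    one factor \<open>s\<close> is multiplied in and cancelled at the very end, which is where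
    \<open>s0\<close> enters.\<close>
  have *: "s * (\<alpha> * \<gamma>) ^ (m - k) = s ^ (n - 2 * k)" if "k \<le> m" for k
  proof -
    have "n - 2 * k = Suc (2 * (m - k))" using that by (simp add: n_def)
    then show ?thesis by (simp add: s2[symmetric] power_mult[symmetric])
  qed
  have **: "\<beta> ^ Suc (2 * j) * \<beta>' ^ (2 * n - Suc (2 * j)) = s * (\<alpha> ^ j * \<gamma> ^ (2 * m - j))" if "j < n" for j
  proof -
    have "2 * n - Suc (2 * j) = Suc (2 * (2 * m - j))" using that by (simp add: n_def)
    then show ?thesis by (simp add: s_def sq[symmetric] power_mult[symmetric])
  qed
  have "2 * (s * (2 ^ n * (\<Sum>k\<le>m. of_nat (n choose (2 * k)) * x ^ (2 * k) * (\<alpha> * \<gamma>) ^ (m - k))))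
    = 2 ^ n * (2 * (\<Sum>k\<le>m. of_nat (n choose (2 * k)) * x ^ (2 * k) * (s * (\<alpha> * \<gamma>) ^ (m - k))))"
    by (simp add: sum_distrib_left mult_ac)
  also have "\<dots> = 2 ^ n * (2 * (\<Sum>k\<le>n div 2. of_nat (n choose (2 * k)) * x ^ (2 * k) * s ^ (n - 2 * k)))"
    using * n by simp
  also have "\<dots> = (2 * (s + x)) ^ n + (2 * (s - x)) ^ n"
    unfolding power_add_plus_power_diff[symmetric] power_mult_distrib by (simp add: algebra_simps)
  \<comment> \<open>As \<open>n\<close> is odd, the sign in \<open>minus\<close> survives; the sum
    of powers becomes a difference, which selects the binomials of odd index.\<close>
  also have "\<dots> = (\<beta>' + \<beta>) ^ (2 * n) - (\<beta>' - \<beta>) ^ (2 * n)"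
    unfolding plus minus using n by (simp add: power_mult[symmetric])
  also have "\<dots> = 2 * (\<Sum>j<n. of_nat ((2 * n) choose Suc (2 * j)) *
      (\<beta> ^ Suc (2 * j) * \<beta>' ^ (2 * n - Suc (2 * j))))"
    unfolding power_add_minus_power_diff by (simp add: mult_ac)
  also have "\<dots> = 2 * (\<Sum>j<n. of_nat ((2 * n) choose Suc (2 * j)) * (s * (\<alpha> ^ j * \<gamma> ^ (2 * m - j))))"
    using ** by simp
  also have "\<dots> = 2 * (s * (\<Sum>j<n. of_nat ((2 * n) choose Suc (2 * j)) * \<alpha> ^ j * \<gamma> ^ (2 * m - j)))"
    by (simp add: sum_distrib_left mult_ac)
  finally show ?thesis using s0 by simp
qed

text \<open>Pascal's rule: two neighbouring entries of row p - 1 add up to an entry of row p that is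
  divisible by p, so the entries alternate in sign.\<close>

lemma prime_minus_one_choose_cong:
  assumes "prime p" "k < p"
  shows "[int ((p - 1) choose k) = (- 1) ^ k] (mod int p)"
  using assms(2)
proof (induction k)
  case (Suc k)
  have "p = Suc (p - 1)" using assms(1) prime_gt_0_nat[of p] by simp
  then have "p choose Suc k = ((p - 1) choose k) + ((p - 1) choose Suc k)"
    by (metis binomial_Suc_Suc)
  moreover have "p dvd p choose Suc k"
    using Suc.prems assms(1) by (intro dvd_choose_prime) auto
  ultimately have "[int ((p - 1) choose Suc k) = - int ((p - 1) choose k)] (mod int p)"
    by (simp add: cong_iff_dvd_diff add.commute flip: of_nat_add)
  also have "[- int ((p - 1) choose k) = - ((- 1) ^ k)] (mod int p)"
    using Suc by (simp add: cong_minus_minus_iff)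
  finally show ?case by simp
qed simp

lemma Suc_times_central_binomial_Suc:
  "Suc j * ((2 * Suc j) choose Suc j) = 2 * Suc (2 * j) * ((2 * j) choose j)"
proof -
  have "Suc j * (Suc (Suc (2 * j)) choose Suc j) = Suc (Suc (2 * j)) * (Suc (2 * j) choose j)"
    by (rule Suc_times_binomial)
  also have "Suc (2 * j) choose j = Suc (2 * j) choose Suc j"
    using binomial_symmetric[of j "Suc (2 * j)"] by simp
  also have "Suc (Suc (2 * j)) * (Suc (2 * j) choose Suc j) = 2 * (Suc j * (Suc (2 * j) choose Suc j))"
    by simp
  also have "\<dots> = 2 * Suc (2 * j) * ((2 * j) choose j)"
    by (simp only: Suc_times_binomial mult.assoc)
  finally show ?thesis by simp
qed

text \<open>The central binomial coefficient is (-4)^j times the generalized binomial of -1/2 over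
  j, and n == -1/2 modulo p. The induction compares the ratios of consecutive terms; the denominator
  j + 1 <= n is invertible modulo p.\<close>

lemma central_binomial_cong:
  fixes p n :: nat
  assumes "prime p" "p = 2 * n + 1" "j \<le> n"
  shows "[int ((2 * j) choose j) = (- 4) ^ j * int (n choose j)] (mod int p)"
  using assms(3)
proof (induction j)
  case (Suc j)
  have cop: "coprime (int (Suc j)) (int p)"
    using assms(1,2) Suc.prems
    by (metis Suc_le_lessD coprime_commute coprime_int_iff mult_2 le_add1 less_trans nat_dvd_not_less
        add.commute less_add_one order_le_less_trans prime_imp_coprime zero_less_Suc)
  have "int (Suc j) * int (n choose Suc j) = (int n - int j) * int (n choose j)"
    using binomial_absorption[of j n] binomial_absorb_comp[of n j] Suc.prems
    by (metis of_nat_diff of_nat_mult Suc_leD)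
  then have "(- 4) ^ j * (- 4) * (int (Suc j) * int (n choose Suc j)) = - 4 * (int n - int j) * ((- 4) ^ j * int (n choose j))"
    by (simp only: mult_ac)
  moreover have "[- 4 * (int n - int j) * ((- 4) ^ j * int (n choose j)) = 2 * int (Suc (2 * j)) * int ((2 * j) choose j)] (mod int p)"
  proof (rule cong_mult)
    \<comment> \<open>The two ratios agree because the difference is -4n - 2 = -2p.\<close>
    have "- 4 * (int n - int j) - 2 * int (Suc (2 * j)) = int p * (- 2)"
      using assms(2) by simp
    then show "[- 4 * (int n - int j) = 2 * int (Suc (2 * j))] (mod int p)"
      by (metis cong_iff_dvd_diff dvd_triv_left)
    show "[(- 4) ^ j * int (n choose j) = int ((2 * j) choose j)] (mod int p)"
      using Suc by (simp add: cong_sym)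
  qed
  moreover have "2 * int (Suc (2 * j)) * int ((2 * j) choose j) = int (Suc j) * int ((2 * Suc j) choose Suc j)"
    using Suc_times_central_binomial_Suc[of j] by (metis of_nat_mult of_nat_numeral)
  ultimately have "[int (Suc j) * int ((2 * Suc j) choose Suc j) = int (Suc j) * ((- 4) ^ Suc j * int (n choose Suc j))] (mod int p)"
    by (simp add: cong_sym_eq mult_ac)
  then show ?case using cop by (simp only: cong_mult_lcancel)
qed simp

section \<open>Even binomial sums modulo p\<close>

text \<open>With s^2 = N this is ((s + x)^n + (s - x)^n) / 2 for even n, and the same divided by s
  for odd n; only powers of N remain, so it is an integer.\<close>

definition even_binomial_sum :: "nat \<Rightarrow> int \<Rightarrow> int \<Rightarrow> int" where
  "even_binomial_sum n x N =
     (\<Sum>k\<le>n div 2. int (n choose (2 * k)) * x ^ (2 * k) * N ^ (n div 2 - k))"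

text \<open>The binomials of row p - 1 = 4m met here have even index, so each is 1 modulo p; the
  factor \<alpha> - \<open>cnj \<alpha>\<close> then telescopes the remaining geometric sum.\<close>

lemma even_binomial_sum_gcong_1:
  fixes x y :: int
  assumes p: "prime p" "p = 4 * m + 1"
  defines "\<alpha> \<equiv> of_int x + of_int y * \<i>"
  shows "gcong (2 ^ (2 * m) * of_int (even_binomial_sum (2 * m) x (x\<^sup>2 + y\<^sup>2)) * (\<alpha> - cnj \<alpha>))
    (\<alpha> ^ Suc (2 * m) - cnj \<alpha> ^ Suc (2 * m)) (of_nat p)"
proof -
  have \<alpha>: "gauss_int \<alpha>" by (simp add: \<alpha>_def)
  have N: "\<alpha> * cnj \<alpha> = of_int (x\<^sup>2 + y\<^sup>2)"
    unfolding \<alpha>_def by (rule mult_cnj_of_int_plus_ii)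
  have "2 ^ (2 * m) * of_int (even_binomial_sum (2 * m) x (x\<^sup>2 + y\<^sup>2)) =
      2 ^ (2 * m) * (\<Sum>k\<le>m. of_nat ((2 * m) choose (2 * k)) * of_int x ^ (2 * k) * (\<alpha> * cnj \<alpha>) ^ (m - k))"
    by (simp add: even_binomial_sum_def N)
  also have "\<dots> = (\<Sum>j\<le>2 * m. of_nat ((4 * m) choose (2 * j)) * \<alpha> ^ j * cnj \<alpha> ^ (2 * m - j))"
    by (rule even_binomial_identity) (simp add: \<alpha>_def)
  finally have 1: "2 ^ (2 * m) * of_int (even_binomial_sum (2 * m) x (x\<^sup>2 + y\<^sup>2)) = \<dots>" .
  have 2: "gcong (\<Sum>j\<le>2 * m. of_nat ((4 * m) choose (2 * j)) * \<alpha> ^ j * cnj \<alpha> ^ (2 * m - j))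
      (\<Sum>j\<le>2 * m. \<alpha> ^ j * cnj \<alpha> ^ (2 * m - j)) (of_nat p)"
  proof (rule gcong_sum)
    fix j assume j: "j \<in> {..2 * m}"
    have "[int ((p - 1) choose (2 * j)) = (- 1) ^ (2 * j)] (mod int p)"
      using j p by (intro prime_minus_one_choose_cong) auto
    then have "[int ((4 * m) choose (2 * j)) = 1] (mod int p)" using p by simp
    from gcong_mult_left[OF gcong_of_int[OF this], of "\<alpha> ^ j * cnj \<alpha> ^ (2 * m - j)"]
    show "gcong (of_nat ((4 * m) choose (2 * j)) * \<alpha> ^ j * cnj \<alpha> ^ (2 * m - j))
        (\<alpha> ^ j * cnj \<alpha> ^ (2 * m - j)) (of_nat p)"
      using \<alpha> by (simp add: mult_ac)
  qed
  have 3: "(\<alpha> - cnj \<alpha>) * (\<Sum>j\<le>2 * m. \<alpha> ^ j * cnj \<alpha> ^ (2 * m - j)) = \<alpha> ^ Suc (2 * m) - cnj \<alpha> ^ Suc (2 * m)"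
    by (simp add: diff_power_eq_sum lessThan_Suc_atMost del: power_Suc)
  show ?thesis
    using gcong_mult_left[OF 2, of "\<alpha> - cnj \<alpha>"] \<alpha> unfolding 1 3 by (simp add: mult.commute)
qed

text \<open>Here (p - 1)/2 is odd and the binomials have odd index, so each is -1 modulo p. This is
  why the difference on the right has the opposite sign from the case p == 1. The norm must be
  nonzero because a square root of it is cancelled in the odd identity.\<close>

lemma even_binomial_sum_gcong_3:
  fixes x y :: int
  assumes p: "prime p" "p = 4 * m + 3" and N0: "x\<^sup>2 + y\<^sup>2 \<noteq> 0"
  defines "\<alpha> \<equiv> of_int x + of_int y * \<i>" and "n \<equiv> Suc (2 * m)"
  shows "gcong (2 ^ n * of_int (even_binomial_sum n x (x\<^sup>2 + y\<^sup>2)) * (\<alpha> - cnj \<alpha>))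
    (cnj \<alpha> ^ n - \<alpha> ^ n) (of_nat p)"
proof -
  have \<alpha>: "gauss_int \<alpha>" by (simp add: \<alpha>_def)
  have N: "\<alpha> * cnj \<alpha> = of_int (x\<^sup>2 + y\<^sup>2)"
    unfolding \<alpha>_def by (rule mult_cnj_of_int_plus_ii)
  have \<alpha>0: "\<alpha> \<noteq> 0" using N N0 by (metis mult_zero_left of_int_0_eq_iff)
  have n: "n div 2 = m" by (simp add: n_def)
  have "2 ^ n * of_int (even_binomial_sum n x (x\<^sup>2 + y\<^sup>2)) =
      2 ^ n * (\<Sum>k\<le>m. of_nat (n choose (2 * k)) * of_int x ^ (2 * k) * (\<alpha> * cnj \<alpha>) ^ (m - k))"
    by (simp add: even_binomial_sum_def N n)
  also have "\<dots> = (\<Sum>j<n. of_nat ((2 * n) choose Suc (2 * j)) * \<alpha> ^ j * cnj \<alpha> ^ (2 * m - j))"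
    unfolding n_def by (rule odd_binomial_identity) (simp add: \<alpha>_def, use \<alpha>0 in simp_all)
  finally have 1: "2 ^ n * of_int (even_binomial_sum n x (x\<^sup>2 + y\<^sup>2)) = \<dots>" .
  have 2: "gcong (\<Sum>j<n. of_nat ((2 * n) choose Suc (2 * j)) * \<alpha> ^ j * cnj \<alpha> ^ (2 * m - j))
      (\<Sum>j<n. - (\<alpha> ^ j * cnj \<alpha> ^ (2 * m - j))) (of_nat p)"
  proof (rule gcong_sum)
    fix j assume j: "j \<in> {..<n}"
    have "[int ((p - 1) choose Suc (2 * j)) = (- 1) ^ Suc (2 * j)] (mod int p)"
      using j p by (intro prime_minus_one_choose_cong) (auto simp: n_def)
    moreover have "p - 1 = 2 * n" using p by (simp add: n_def)
    ultimately have "[int ((2 * n) choose Suc (2 * j)) = - 1] (mod int p)" by simp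
    from gcong_mult_left[OF gcong_of_int[OF this], of "\<alpha> ^ j * cnj \<alpha> ^ (2 * m - j)"]
    show "gcong (of_nat ((2 * n) choose Suc (2 * j)) * \<alpha> ^ j * cnj \<alpha> ^ (2 * m - j))
        (- (\<alpha> ^ j * cnj \<alpha> ^ (2 * m - j))) (of_nat p)"
      using \<alpha> by (simp add: mult_ac)
  qed
  have 3: "(\<alpha> - cnj \<alpha>) * (\<Sum>j<n. - (\<alpha> ^ j * cnj \<alpha> ^ (2 * m - j))) = cnj \<alpha> ^ n - \<alpha> ^ n"
    unfolding n_def sum_negf mult_minus_right diff_power_eq_sum[symmetric] by (rule minus_diff_eq)
  show ?thesis
    using gcong_mult_left[OF 2, of "\<alpha> - cnj \<alpha>"] \<alpha> unfolding 1 3 by (simp add: mult.commute)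
qed

text \<open>
  Twisting by a conjugation and an extra norm factor when \<open>p \<equiv> 3 (mod 4)\<close> makes the
  remaining argument uniform in \<open>p\<close>.
\<close>

definition half_power :: "nat \<Rightarrow> complex \<Rightarrow> complex" where
  "half_power p \<alpha> = (if p mod 4 = 1 then \<alpha> else cnj \<alpha>) ^ ((p + 1) div 4)"

definition norm_factor :: "nat \<Rightarrow> int \<Rightarrow> int" where
  "norm_factor p N = (if p mod 4 = 1 then 1 else N)"

lemma odd_nat_mod_4_cases:
  fixes p :: nat
  assumes "odd p"
  obtains m where "p = 4 * m + 1" | m where "p = 4 * m + 3"
proof -
  have "p mod 4 < 4" "p mod 4 \<noteq> 0" "p mod 4 \<noteq> 2" "p = 4 * (p div 4) + p mod 4"
    using assms by (simp, presburger+)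
  then have "p = 4 * (p div 4) + 1 \<or> p = 4 * (p div 4) + 3" by linarith
  then show ?thesis using that by blast
qed

lemma gauss_int_half_power [simp]: "gauss_int \<alpha> \<Longrightarrow> gauss_int (half_power p \<alpha>)"
  by (simp add: half_power_def)

lemma even_binomial_sum_gcong:
  fixes x y :: int
  assumes p: "prime p" "odd p" and N0: "x\<^sup>2 + y\<^sup>2 \<noteq> 0"
  defines "\<alpha> \<equiv> of_int x + of_int y * \<i>" and "N \<equiv> x\<^sup>2 + y\<^sup>2" and "n \<equiv> (p - 1) div 2"
  shows "gcong (of_int (2 ^ n * even_binomial_sum n x N * norm_factor p N) * (\<alpha> - cnj \<alpha>))
    ((half_power p \<alpha>)\<^sup>2 * \<alpha> - (cnj (half_power p \<alpha>))\<^sup>2 * cnj \<alpha>) (of_nat p)"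
  using p(2)
proof (cases p rule: odd_nat_mod_4_cases)
  case (1 m)
  then have m: "p mod 4 = 1" "n = 2 * m" "(p + 1) div 4 = m" by (auto simp: n_def)
  have sq: "(z ^ m)\<^sup>2 * z = z ^ Suc (2 * m)" for z :: complex
    by (metis power_Suc2 power_mult mult.commute)
  have "gcong (2 ^ n * of_int (even_binomial_sum n x N) * (\<alpha> - cnj \<alpha>))
      (\<alpha> ^ Suc n - cnj \<alpha> ^ Suc n) (of_nat p)"
    using even_binomial_sum_gcong_1[OF p(1) 1, of x y, folded \<alpha>_def N_def] m by simp
  moreover have "(half_power p \<alpha>)\<^sup>2 * \<alpha> = \<alpha> ^ Suc n"
      "(cnj (half_power p \<alpha>))\<^sup>2 * cnj \<alpha> = cnj \<alpha> ^ Suc n"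
    using m sq by (simp_all add: half_power_def del: power_Suc)
  ultimately show ?thesis using m(1) by (simp add: norm_factor_def del: power_Suc)
next
  case (2 m)
  then have m: "p mod 4 = 3" "n = Suc (2 * m)" "(p + 1) div 4 = Suc m" by (auto simp: n_def)
  have \<alpha>: "gauss_int \<alpha>" by (simp add: \<alpha>_def)
  have N: "\<alpha> * cnj \<alpha> = of_int N"
    unfolding \<alpha>_def N_def by (rule mult_cnj_of_int_plus_ii)
  \<comment> \<open>Multiplying by N = \<alpha> \<open>cnj \<alpha>\<close> raises the exponent n =
    2m + 1 to the even number 2 (m + 1), so that squares of \<open>half_power\<close> appear and one
    \<alpha> is left over, exactly as for p == 1.\<close>
  have "of_int N * (cnj \<alpha> ^ n - \<alpha> ^ n) = (half_power p \<alpha>)\<^sup>2 * \<alpha> - (cnj (half_power p \<alpha>))\<^sup>2 * cnj \<alpha>"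
    using m by (simp add: half_power_def N[symmetric] power2_eq_square power_add mult_2_right algebra_simps)
  then show ?thesis
    using gcong_mult_left[OF even_binomial_sum_gcong_3[OF p(1) 2 N0, folded \<alpha>_def N_def], of "of_int N"] m
    by (simp add: norm_factor_def mult_ac)
qed

text \<open>The exponent (p + 1) div 4 exceeds p div 4 by one precisely when p == 3 (mod 4);
  \<open>norm_factor\<close> accounts for this extra power of N.\<close>

lemma half_power_mult_cnj:
  assumes "odd p" "\<alpha> * cnj \<alpha> = of_int N"
  shows "half_power p \<alpha> * cnj (half_power p \<alpha>) = of_int (N ^ (p div 4) * norm_factor p N)"
  using assms(1)
proof (cases p rule: odd_nat_mod_4_cases)
  case (1 m)
  then have "p mod 4 = 1" "p div 4 = m" "(p + 1) div 4 = m" by auto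
  then show ?thesis
    using assms(2) by (simp add: half_power_def norm_factor_def flip: power_mult_distrib)
next
  case (2 m)
  then have "p mod 4 = 3" "p div 4 = m" "(p + 1) div 4 = Suc m" by auto
  then have "half_power p \<alpha> * cnj (half_power p \<alpha>) = (\<alpha> * cnj \<alpha>) ^ Suc m"
    by (simp add: half_power_def power_mult_distrib mult_ac)
  then show ?thesis
    using \<open>p mod 4 = 3\<close> \<open>p div 4 = m\<close> by (simp add: assms(2) norm_factor_def)
qed

text \<open>The map from \<alpha> to i times its conjugate exchanges real and imaginary part.
  Whichever branch of \<open>half_power\<close> applies, it contributes a power of i or of -i, and
  the squares of these agree.\<close>

lemma half_power_ii_mult_cnj:
  "(half_power p (\<i> * cnj \<alpha>))\<^sup>2 = (- 1) ^ ((p + 1) div 4) * (cnj (half_power p \<alpha>))\<^sup>2"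
proof -
  have "(\<i> ^ k)\<^sup>2 = (- 1) ^ k" "((- \<i>) ^ k)\<^sup>2 = (- 1) ^ k" for k
    by (simp_all only: power_mult[symmetric] mult.commute[of k 2])
      (simp_all add: power_mult)
  moreover have "(- (\<i> * \<alpha>)) ^ k = (- \<i>) ^ k * \<alpha> ^ k" for k
    by (simp flip: power_mult_distrib)
  ultimately show ?thesis
    by (simp add: half_power_def power_mult_distrib)
qed

text \<open>The second supplementary law of quadratic reciprocity, obtained by specializing the
  general congruence to \<alpha> = i; the spare factor 2 stays until everything is cancelled at
  once.\<close>

lemma two_power_gcong:
  assumes p: "prime p" "odd p"
  shows "gcong (2 ^ ((p - 1) div 2) * 2) ((- 1) ^ ((p + 1) div 4) * 2) (of_nat p)"
proof -
  \<comment> \<open>For x = 0 only the term k = 0 of the binomial sum survives.\<close>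
  have "{..m} = insert 0 {1..m}" for m :: nat by auto
  then have E: "even_binomial_sum n 0 1 = 1" for n
    by (auto simp: even_binomial_sum_def intro!: sum.neutral)
  have hp: "(half_power p \<i>)\<^sup>2 = (- 1) ^ ((p + 1) div 4)"
    using half_power_ii_mult_cnj[of p 1] by (simp add: half_power_def)
  have "(cnj (half_power p \<i>))\<^sup>2 = cnj ((half_power p \<i>)\<^sup>2)" by simp
  then have hp': "(cnj (half_power p \<i>))\<^sup>2 = (- 1) ^ ((p + 1) div 4)"
    by (simp only: hp) simp
  have "gcong (2 ^ ((p - 1) div 2) * (2 * \<i>)) (2 * (\<i> * (- 1) ^ ((p + 1) div 4))) (of_nat p)"
    using even_binomial_sum_gcong[OF p, of 0 1]
    by (simp add: E hp hp' norm_factor_def mult_2_right distrib_left)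
  from gcong_mult_left[OF this, of "- \<i>"]
  have "gcong (- \<i> * (2 ^ ((p - 1) div 2) * (2 * \<i>))) (- \<i> * (2 * (\<i> * (- 1) ^ ((p + 1) div 4)))) (of_nat p)"
    by simp
  moreover have "- \<i> * (a * (2 * \<i>)) = a * 2" "- \<i> * (2 * (\<i> * a)) = a * 2" for a
    by (simp_all add: complex_eq_iff)
  ultimately show ?thesis by (simp only:)
qed

section \<open>Frobenius and prime divisors in the Gaussian integers\<close>

lemma fermat_int:
  fixes x :: int
  assumes "prime p"
  shows "[x ^ p = x] (mod int p)"
proof (cases "int p dvd x")
  case True
  then have "[x = 0] (mod int p)" by (simp add: cong_0_iff)
  then have "[x ^ p = 0 ^ p] (mod int p)" "[0 = x] (mod int p)"
    by (auto intro: cong_pow simp: cong_sym_eq)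
  then show ?thesis using assms by (metis cong_trans not_prime_0 power_0_left)
next
  case False
  define r where "r = nat (x mod int p)"
  have p0: "int p > 0" using assms prime_gt_0_nat by simp
  then have r: "int r = x mod int p" by (simp add: r_def)
  then have xr: "[x = int r] (mod int p)" by (simp add: cong_def)
  then have "\<not> p dvd r" using False by (metis cong_dvd_iff int_dvd_int_iff cong_sym dvd_refl cong_0_iff cong_trans)
  then have "[r ^ (p - 1) = 1] (mod p)" by (rule fermat_theorem[OF assms])
  then have "[int r ^ (p - 1) = 1] (mod int p)"
    by (metis cong_int_iff of_nat_power of_nat_1)
  then have "[int r * int r ^ (p - 1) = int r * 1] (mod int p)" by (rule cong_scalar_left)
  then have "[int r ^ p = int r] (mod int p)"
    using p0 by (metis mult_1_right of_nat_0_less_iff power_minus_mult mult.commute)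
  then show ?thesis using xr by (metis cong_pow cong_trans cong_sym)
qed

text \<open>The inner binomials vanish modulo p and Fermat reduces the integer coefficients. The
  power of i is left unevaluated: it is i or -i according to p modulo 4, giving the identity or
  conjugation.\<close>

lemma gauss_frobenius:
  fixes x y :: int
  assumes "prime p"
  shows "gcong ((of_int x + of_int y * \<i>) ^ p) (of_int x + of_int y * \<i> ^ p) (of_nat p)"
proof -
  have p0: "0 < p" using assms prime_gt_0_nat by simp
  define f where "f = (\<lambda>k. of_nat (p choose k) * of_int x ^ k * (of_int y * \<i>) ^ (p - k) :: complex)"
  have "{..p} = insert p (insert 0 {0<..<p})" using p0 by auto
  then have "(of_int x + of_int y * \<i>) ^ p = of_int x ^ p + ((of_int y * \<i>) ^ p + sum f {0<..<p})"
    unfolding binomial_ring f_def using p0 by simp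
  moreover have "gcong (sum f {0<..<p}) (\<Sum>k\<in>{0<..<p}. 0) (of_nat p)"
  proof (rule gcong_sum)
    fix k assume "k \<in> {0<..<p}"
    then have "p dvd p choose k" using assms by (intro dvd_choose_prime) auto
    then obtain c where "p choose k = p * c" by auto
    then have "f k = of_nat p * (of_nat c * of_int x ^ k * (of_int y * \<i>) ^ (p - k))"
      by (simp add: f_def)
    then show "gcong (f k) 0 (of_nat p)" by (simp add: gcong_def)
  qed
  moreover have "gcong (of_int x ^ p) (of_int x) (of_nat p)"
    using gcong_of_int[OF fermat_int[OF assms, of x]] by simp
  moreover have "gcong ((of_int y * \<i>) ^ p) (of_int y * \<i> ^ p) (of_nat p)"
    using gcong_mult_left[OF gcong_of_int[OF fermat_int[OF assms, of y]], of "\<i> ^ p"]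
    by (simp add: power_mult_distrib mult.commute)
  ultimately show ?thesis
    using gcong_add[OF _ gcong_add, of _ _ _ _ _ "sum f {0<..<p}" 0] by fastforce
qed

text \<open>Raising x^2 == -y^2 to the odd power (p - 1)/2 gives x^(p-1) == -y^(p-1), which
  contradicts Fermat unless p divides both numbers.\<close>

lemma prime_dvd_sum_two_squares_3_mod_4:
  fixes x y :: int
  assumes p: "prime p" "p = 4 * m + 3" and dvd: "int p dvd x\<^sup>2 + y\<^sup>2"
  shows "int p dvd y"
proof (rule ccontr)
  assume y: "\<not> int p dvd y"
  have pp: "prime (int p)" using p(1) by simp
  have "[x\<^sup>2 = - (y\<^sup>2)] (mod int p)" using dvd by (simp add: cong_iff_dvd_diff)
  then have "[(x\<^sup>2) ^ Suc (2 * m) = (- (y\<^sup>2)) ^ Suc (2 * m)] (mod int p)" by (rule cong_pow)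
  moreover have "(x\<^sup>2) ^ Suc (2 * m) = x ^ (p - 1)" "(- (y\<^sup>2)) ^ Suc (2 * m) = - (y ^ (p - 1))"
    using p(2) by (simp_all add: power_mult[symmetric] flip: power_Suc)
  ultimately have 1: "[x ^ (p - 1) = - (y ^ (p - 1))] (mod int p)" by simp
  have fermat: "[z ^ (p - 1) = 1] (mod int p)" if "\<not> int p dvd z" for z :: int
  proof -
    have "coprime z (int p)" using that pp by (metis coprime_commute prime_imp_coprime)
    moreover have "[z * z ^ (p - 1) = z * 1] (mod int p)"
      using fermat_int[OF p(1), of z] p(2) by (simp add: numeral_eq_Suc)
    ultimately show ?thesis using cong_mult_lcancel by blast
  qed
  have "\<not> int p dvd x"
  proof
    assume "int p dvd x"
    then have "int p dvd x\<^sup>2" by (simp add: power2_eq_square)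
    then have "int p dvd y\<^sup>2" using dvd by (simp add: dvd_add_right_iff)
    then show False using y pp prime_dvd_power by blast
  qed
  then have "[1 = - 1] (mod int p)"
    using fermat[OF y] fermat[of x] 1
    by (metis cong_minus_minus_iff cong_sym cong_trans)
  then have "int p dvd 2" by (simp add: cong_iff_dvd_diff)
  then have "int p \<le> 2" by (rule zdvd_imp_le) simp
  then show False using p(2) by simp
qed

text \<open>If p divides a product, it divides the product of the norms, hence one norm; a sum of
  two squares divisible by p has both entries divisible by p.\<close>

lemma gauss_prime_3_mod_4:
  assumes p: "prime p" "p = 4 * m + 3"
  shows "gauss_prime (of_nat p)"
proof -
  have both: "int p dvd x \<and> int p dvd y" if "int p dvd x\<^sup>2 + y\<^sup>2" for x y :: int
    using prime_dvd_sum_two_squares_3_mod_4[OF p, of x y] that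
      prime_dvd_sum_two_squares_3_mod_4[OF p, of y x] by (simp add: add.commute)
  have "gdvd (of_nat p) a \<or> gdvd (of_nat p) b"
    if ab: "gauss_int a" "gauss_int b" "gdvd (of_nat p) (a * b)" for a b
  proof -
    obtain x y u v where xy: "a = of_int x + of_int y * \<i>" and uv: "b = of_int u + of_int v * \<i>"
      using ab gauss_intE by metis
    have "gdvd (of_int (int p)) (a * b * (cnj a * cnj b))"
      using ab gdvd_mult[of "of_nat p" "a * b" "cnj a * cnj b"] by simp
    moreover have "a * b * (cnj a * cnj b) = (a * cnj a) * (b * cnj b)" by (simp add: mult_ac)
    moreover have "\<dots> = of_int ((x\<^sup>2 + y\<^sup>2) * (u\<^sup>2 + v\<^sup>2))"
      unfolding xy uv mult_cnj_of_int_plus_ii by simp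
    ultimately have "int p dvd (x\<^sup>2 + y\<^sup>2) * (u\<^sup>2 + v\<^sup>2)" by (simp only: gdvd_of_int_iff)
    then have "int p dvd x\<^sup>2 + y\<^sup>2 \<or> int p dvd u\<^sup>2 + v\<^sup>2"
      using p(1) by (simp add: prime_dvd_mult_iff)
    then have "gdvd (of_int (int p)) a \<or> gdvd (of_int (int p)) b"
      unfolding xy uv gdvd_of_int_plus_ii_iff using both by blast
    then show ?thesis by simp
  qed
  moreover have "\<not> gdvd (of_nat p) 1"
    using gdvd_of_int_iff[of "int p" 1] p by auto
  moreover have "of_nat p \<noteq> (0 :: complex)" using p(1) by auto
  ultimately show ?thesis by (simp add: gauss_prime_def)
qed

text \<open>Euler's criterion with the even exponent (p - 1)/2 = 2m: a Legendre symbol 0 or -1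
  congruent to 1 would force p <= 2.\<close>

lemma ex_sqrt_minus_one_mod:
  assumes p: "prime p" "p = 4 * m + 1"
  obtains r :: int where "int p dvd r\<^sup>2 + 1"
proof -
  have "p > 2" using p prime_gt_1_nat[OF p(1)] by simp
  then have "[Legendre (- 1) (int p) = (- 1) ^ ((p - 1) div 2)] (mod int p)"
    using p euler_criterion by blast
  then have *: "[Legendre (- 1) (int p) = 1] (mod int p)" using p by simp
  have "QuadRes (int p) (- 1)"
  proof (rule ccontr)
    assume "\<not> QuadRes (int p) (- 1)"
    then have "Legendre (- 1) (int p) = 0 \<or> Legendre (- 1) (int p) = - 1" by (simp add: Legendre_def)
    then have "int p dvd 1 \<or> int p dvd 2" using * by (auto simp: cong_iff_dvd_diff)
    then have "int p \<le> 2" using zdvd_imp_le[of "int p" 1] zdvd_imp_le[of "int p" 2] by auto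
    then show False using \<open>p > 2\<close> by simp
  qed
  then show ?thesis using that by (auto simp: QuadRes_def cong_iff_dvd_diff)
qed

text \<open>Thue's pigeonhole argument: a small nonzero vector (u, v) with u == r v, where r^2 ==
  -1, has u^2 + v^2 strictly between 0 and 2p and divisible by p.\<close>

lemma prime_sum_two_squares:
  assumes p: "prime p" "p = 4 * m + 1"
  obtains x y :: int where "x\<^sup>2 + y\<^sup>2 = int p"
proof -
  obtain r :: int where r: "int p dvd r\<^sup>2 + 1" using ex_sqrt_minus_one_mod[OF p] .
  have p0: "0 < int p" using p by simp
  define s where "s = nat \<lfloor>sqrt p\<rfloor>"
  have s_le: "int s \<le> sqrt p" and s_lt: "sqrt p < real s + 1" by (auto simp: s_def)
  from s_le have "(real s)\<^sup>2 \<le> (sqrt p)\<^sup>2" by (intro power_mono) auto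
  then have "real (s ^ 2) \<le> real p" by simp
  then have ss: "s ^ 2 \<le> p" by (simp only: of_nat_le_iff)
  \<comment> \<open>Strictness of s^2 < p is what keeps u^2 + v^2 below 2p.\<close>
  have "s ^ 2 \<noteq> p" using p(1) by (metis prime_power_iff numeral_eq_one_iff semiring_norm(85))
  with ss have ss: "(int s)\<^sup>2 < int p" by (metis le_neq_implies_less of_nat_less_iff of_nat_power)
  from s_lt have "(sqrt p)\<^sup>2 < (real s + 1)\<^sup>2" by (intro power_strict_mono) auto
  then have "real p < real ((s + 1) ^ 2)" by (simp add: algebra_simps)
  then have big: "p < (s + 1) ^ 2" by (simp only: of_nat_less_iff)
  define A where "A = {0..int s} \<times> {0..int s}"
  \<comment> \<open>There are (s + 1)^2 > p pairs in \<open>A\<close> and only p residues; the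
    difference of two colliding pairs is the required vector.\<close>
  define f where "f = (\<lambda>(i, j). (i - r * j) mod int p)"
  have "f ` A \<subseteq> {0..<int p}" using p0 by (auto simp: f_def)
  then have "card (f ` A) \<le> p" using card_mono[of "{0..<int p}" "f ` A"] by simp
  moreover have "card A = (s + 1) ^ 2" by (simp add: A_def power2_eq_square nat_add_distrib)
  ultimately have "\<not> inj_on f A" using big card_image by fastforce
  then obtain i j i' j' where A: "(i, j) \<in> A" "(i', j') \<in> A" and ne: "(i, j) \<noteq> (i', j')"
    and eq: "f (i, j) = f (i', j')" by (auto simp: inj_on_def)
  define u v where "u = i - i'" "v = j - j'"
  have "[i - r * j = i' - r * j'] (mod int p)" using eq by (simp add: f_def cong_def)
  then have "int p dvd u - r * v" by (simp add: cong_iff_dvd_diff u_v_def algebra_simps)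
  then have "int p dvd (u - r * v) * (u + r * v) + v\<^sup>2 * (r\<^sup>2 + 1)" using r by simp
  also have "(u - r * v) * (u + r * v) + v\<^sup>2 * (r\<^sup>2 + 1) = u\<^sup>2 + v\<^sup>2"
    by (simp add: algebra_simps power2_eq_square)
  finally obtain k where k: "u\<^sup>2 + v\<^sup>2 = int p * k" by (elim dvdE)
  have "\<bar>u\<bar> \<le> int s" "\<bar>v\<bar> \<le> int s" using A by (auto simp: A_def u_v_def)
  then have "u\<^sup>2 \<le> (int s)\<^sup>2" "v\<^sup>2 \<le> (int s)\<^sup>2" by (simp_all add: abs_le_square_iff[symmetric])
  then have "int p * k < int p * 2" using ss k by linarith
  then have "k < 2" using p0 by simp
  moreover have "0 < u\<^sup>2 + v\<^sup>2" using ne by (auto simp: u_v_def sum_power2_gt_zero_iff)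
  then have "0 < k" using k p0 by (simp add: zero_less_mult_iff)
  ultimately have "k = 1" by simp
  then show ?thesis using that k by simp
qed

section \<open>The quartic symbol\<close>

lemma gauss_prime_gdvd_mult:
  "gauss_prime q \<Longrightarrow> gauss_int a \<Longrightarrow> gauss_int b \<Longrightarrow> gdvd q (a * b) \<longleftrightarrow> gdvd q a \<or> gdvd q b"
  unfolding gauss_prime_def using gdvd_mult[of q a b] gdvd_mult[of q b a] by (auto simp: mult.commute)

lemma gcong_cancel_left:
  assumes "gauss_prime q" "\<not> gdvd q a" "gauss_int a" "gauss_int b" "gauss_int c" "gcong (a * b) (a * c) q"
  shows "gcong b c q"
  using assms gauss_prime_gdvd_mult[of q a "b - c"] by (simp add: gcong_def algebra_simps)

text \<open>Existence: \<open>\<alpha> ^ (4 * k) - 1\<close> is a product of four linear factors in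
  \<open>\<alpha> ^ k\<close>, and the prime \<open>q\<close> divides one. Uniqueness: distinct
  candidates differ by an element of norm 1, 2 or 4, which the odd norm \<open>P\<close> of a
  non-unit cannot divide. Together they make the \<open>THE\<close> in \<open>qsym4\<close>
  meaningful.\<close>

lemma qsym4_spec:
  assumes q: "gauss_prime q" "q * cnj q = of_int P" "odd P"
    and \<alpha>: "gauss_int \<alpha>" "gcong (\<alpha> ^ (4 * k)) 1 q"
    and k: "k = (gnorm q - 1) div 4"
  shows "qsym4 \<alpha> q \<in> {1, \<i>, -1, -\<i>}" "gcong (\<alpha> ^ k) (qsym4 \<alpha> q) q"
proof -
  let ?V = "{0, 1, \<i>, -1, -\<i>} :: complex set"
  have gq: "gauss_int q" using q(1) by (simp add: gauss_prime_def)
  have P4: "\<not> P dvd 4"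
  proof
    assume "P dvd 4"
    moreover have "coprime P 4"
      using q(3) by (metis coprime_power_right_iff coprime_right_2_iff_odd mult_2_right numeral_Bit0 power2_eq_square one_add_one mult_2)
    ultimately have "P dvd 1" by (metis coprime_common_divisor dvd_refl)
    then have "gdvd q (of_int P)" "gdvd (of_int P) 1"
      using gdvd_triv[of "cnj q" q] gq q(2) gdvd_of_int[of P 1] by auto
    then have "gdvd q 1" using gdvd_trans by blast
    then show False using q(1) by (simp add: gauss_prime_def)
  qed
  have distinct: "v = w" if "v \<in> ?V" "w \<in> ?V" "gcong v w q" for v w
  proof (rule ccontr)
    assume "v \<noteq> w"
    then have "(v - w) * cnj (v - w) \<in> {of_int 1, of_int 2, of_int 4}"
      using that(1,2) by (elim insertE emptyE) (simp_all add: algebra_simps complex_eq_iff)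
    then obtain d :: int where d: "d \<in> {1, 2, 4}" "(v - w) * cnj (v - w) = of_int d" by blast
    have "P dvd d" using that(3) d q by (intro gdvd_norm[of q "v - w"]) (auto simp: gcong_def)
    moreover have "d dvd 4" using d(1) by auto
    ultimately show False using P4 dvd_trans by blast
  qed
  have "\<exists>v\<in>{1, \<i>, -1, -\<i>}. gcong (\<alpha> ^ k) v q"
  proof -
    let ?w = "\<alpha> ^ k"
    have "(?w - 1) * ((?w - (-1)) * ((?w - \<i>) * (?w - (- \<i>)))) = \<alpha> ^ (4 * k) - 1"
      by (simp add: algebra_simps power_mult mult.commute[of 4] power4_eq_xxxx)
    then have "gdvd q ((?w - 1) * ((?w - (-1)) * ((?w - \<i>) * (?w - (- \<i>)))))"
      using \<alpha>(2) by (simp only: gcong_def)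
    then show ?thesis
      using q(1) \<alpha>(1) by (auto simp: gauss_prime_gdvd_mult gcong_def)
  qed
  then obtain v where v: "v \<in> {1, \<i>, -1, -\<i>}" "gcong (\<alpha> ^ k) v q" by blast
  have "qsym4 \<alpha> q = v"
    unfolding qsym4_def k[symmetric]
  proof (rule the_equality)
    show "v \<in> ?V \<and> gcong (\<alpha> ^ k) v q" using v by blast
    show "w = v" if "w \<in> ?V \<and> gcong (\<alpha> ^ k) w q" for w
    proof (rule distinct)
      show "gcong w v q" using that v(2) gcong_sym gcong_trans by blast
    qed (use that v(1) in blast)+
  qed
  then show "qsym4 \<alpha> q \<in> {1, \<i>, -1, -\<i>}" "gcong (\<alpha> ^ k) (qsym4 \<alpha> q) q"
    using v by simp_all
qed

section \<open>Fermat's theorem for Gaussian integers\<close>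

lemma ii_power_cases: "\<i> ^ (4 * m + 1) = \<i>" "\<i> ^ (4 * m + 3) = - \<i>"
  by (simp_all add: power_add power_mult power4_eq_xxxx numeral_3_eq_3)

lemma gnorm_eq:
  assumes "q * cnj q = of_nat P"
  shows "gnorm q = P"
proof -
  have "of_real ((Re q)\<^sup>2 + (Im q)\<^sup>2) = (of_real (real P) :: complex)"
    using assms by (simp add: complex_mult_cnj)
  then have "(Re q)\<^sup>2 + (Im q)\<^sup>2 = real P" by (simp only: of_real_eq_iff)
  then show ?thesis by (simp add: gnorm_def)
qed

text \<open>Here i^p = i, so Frobenius is the identity modulo p; one factor \<alpha>, prime to
  \<open>q\<close> by its norm, is cancelled.\<close>

lemma gauss_fermat_1:
  fixes x y :: int
  assumes p: "prime p" "p = 4 * m + 1" and q: "gauss_int q" "q * cnj q = of_nat p"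
    and N: "\<not> int p dvd x\<^sup>2 + y\<^sup>2"
  defines "\<alpha> \<equiv> of_int x + of_int y * \<i>"
  shows "gcong (\<alpha> ^ (4 * m)) 1 q"
proof (rule gcong_cancel_left)
  show "gauss_prime q" using p(1) q by (rule gauss_prime_if_norm_prime)
  show "\<not> gdvd q \<alpha>"
    using gdvd_norm[of q \<alpha> "int p" "x\<^sup>2 + y\<^sup>2"] q(2) N mult_cnj_of_int_plus_ii[of x y, folded \<alpha>_def]
    by auto
  have "gdvd q (of_int (int p))"
    by (subst gdvd_of_int_iff_of_norm[OF p(1) q]) simp
  moreover have "gcong (\<alpha> ^ p) \<alpha> (of_nat p)"
    using gauss_frobenius[OF p(1), of x y] ii_power_cases(1)[of m] p(2) by (simp add: \<alpha>_def)
  ultimately have "gcong (\<alpha> ^ p) \<alpha> q" using gcong_modulus by simp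
  then show "gcong (\<alpha> * \<alpha> ^ (4 * m)) (\<alpha> * 1) q" using p(2) by simp
qed (simp_all add: \<alpha>_def)

lemma gauss_frobenius_3:
  fixes x y :: int
  assumes p: "prime p" "p = 4 * m + 3"
  defines "\<alpha> \<equiv> of_int x + of_int y * \<i>"
  shows "gcong (\<alpha> ^ p) (cnj \<alpha>) (of_nat p)"
  using gauss_frobenius[OF p(1), of x y] ii_power_cases(2)[of m] p(2) by (simp add: \<alpha>_def)

text \<open>Frobenius is conjugation, so \<open>\<alpha> ^ (p + 1)\<close> is congruent to the norm,
  a rational integer to which the ordinary theorem of Fermat applies.\<close>

lemma gauss_fermat_3:
  fixes x y :: int
  assumes p: "prime p" "p = 4 * m + 3" and N: "\<not> int p dvd x\<^sup>2 + y\<^sup>2"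
  defines "\<alpha> \<equiv> of_int x + of_int y * \<i>"
  shows "gcong (\<alpha> ^ ((p + 1) * (p - 1))) 1 (of_nat p)"
proof -
  have \<alpha>: "gauss_int \<alpha>" by (simp add: \<alpha>_def)
  have norm: "\<alpha> * cnj \<alpha> = of_int (x\<^sup>2 + y\<^sup>2)"
    unfolding \<alpha>_def by (rule mult_cnj_of_int_plus_ii)
  have "gcong (\<alpha> * \<alpha> ^ p) (\<alpha> * cnj \<alpha>) (of_nat p)"
    unfolding \<alpha>_def by (intro gcong_mult_left gauss_frobenius_3[OF p]) simp
  then have "gcong (\<alpha> ^ (p + 1)) (of_int (x\<^sup>2 + y\<^sup>2)) (of_nat p)" by (simp add: norm)
  then have 1: "gcong ((\<alpha> ^ (p + 1)) ^ (p - 1)) (of_int (x\<^sup>2 + y\<^sup>2) ^ (p - 1)) (of_nat p)"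
    using \<alpha> by (intro gcong_power) auto
  have "coprime (x\<^sup>2 + y\<^sup>2) (int p)"
    using N p(1) by (metis coprime_commute prime_imp_coprime prime_nat_int_transfer)
  moreover have "[(x\<^sup>2 + y\<^sup>2) * (x\<^sup>2 + y\<^sup>2) ^ (p - 1) = (x\<^sup>2 + y\<^sup>2) * 1] (mod int p)"
    using fermat_int[OF p(1), of "x\<^sup>2 + y\<^sup>2"] p(2) by (metis Suc_diff_1 mult_1_right p(1) power_Suc prime_gt_0_nat)
  ultimately have "[(x\<^sup>2 + y\<^sup>2) ^ (p - 1) = 1] (mod int p)"
    using cong_mult_lcancel by blast
  from gcong_of_int[OF this] have "gcong (of_int (x\<^sup>2 + y\<^sup>2) ^ (p - 1)) 1 (of_nat p)" by simp
  with 1 have "gcong ((\<alpha> ^ (p + 1)) ^ (p - 1)) 1 (of_nat p)" by (rule gcong_trans)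
  then show ?thesis by (simp only: power_mult)
qed

text \<open>All that is used of the quartic symbol is this relation between
  \<open>half_power\<close> and its conjugate. The modulus is a Gaussian prime factor of p or p
  itself; the first exported property makes the distinction invisible afterwards.\<close>

lemma half_power_gcong_if_qsym4_p_eq:
  fixes x y :: int
  assumes p: "prime p" "odd p" and N: "\<not> int p dvd x\<^sup>2 + y\<^sup>2"
  defines "\<alpha> \<equiv> of_int x + of_int y * \<i>"
  assumes sym: "qsym4_p \<alpha> p = \<i> ^ r"
  obtains q where "\<And>z. gdvd q (of_int z) \<longleftrightarrow> int p dvd z"
    and "gcong (half_power p \<alpha>) (\<i> ^ r * cnj (half_power p \<alpha>)) q"
  using p(2)
proof (cases p rule: odd_nat_mod_4_cases)
  case (1 m)
  have \<alpha>: "gauss_int \<alpha>" by (simp add: \<alpha>_def)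
  obtain u v :: int where "u\<^sup>2 + v\<^sup>2 = int p" using prime_sum_two_squares[OF p(1) 1] .
  then have "(of_int u + of_int v * \<i>) * cnj (of_int u + of_int v * \<i>) = of_nat p"
    unfolding mult_cnj_of_int_plus_ii by simp
  then have ex: "\<exists>q. gauss_prime q \<and> of_nat p = q * cnj q"
    using gauss_prime_if_norm_prime[OF p(1), of "of_int u + of_int v * \<i>"]
    by (metis gauss_int_add gauss_int_mult gauss_int_numeral(4) gauss_int_of_int)
  define q where "q = (SOME q. gauss_prime q \<and> of_nat p = q * cnj q)"
  have q: "gauss_prime q" "q * cnj q = of_nat p" using someI_ex[OF ex] by (simp_all add: q_def)
  then have gq: "gauss_int q" by (simp add: gauss_prime_def)
  \<comment> \<open>By norms p^2 would divide p. So p divides neither q nor its conjugate though it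
    divides their product: p is not a Gaussian prime, and \<open>qsym4_p\<close> takes its second
    branch.\<close>
  have "\<not> gdvd (of_nat p) z" if "z * cnj z = of_nat p" for z
  proof
    assume "gdvd (of_nat p) z"
    then have "int p * int p dvd int p * 1" using that by (intro gdvd_norm[of "of_nat p" z]) auto
    then have "int p dvd 1" using p(1) by (metis dvd_times_left_cancel_iff not_prime_0 of_nat_eq_0_iff)
    then show False using p(1) by auto
  qed
  from this[of q] this[of "cnj q"] have "\<not> gauss_prime (of_nat p)"
    using q gq gauss_prime_gdvd_mult[of "of_nat p" q "cnj q"] gdvd_triv[of 1 "of_nat p"]
    by (auto simp: mult.commute)
  then have sym': "qsym4 \<alpha> q * qsym4 \<alpha> (cnj q) = \<i> ^ r"
    using sym by (simp add: qsym4_p_def q_def Let_def)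
  have q': "gauss_int (cnj q)" "cnj q * cnj (cnj q) = of_nat p" using q gq by (simp_all add: mult.commute)
  have "m = (gnorm q - 1) div 4" "m = (gnorm (cnj q) - 1) div 4"
    using gnorm_eq[OF q(2)] gnorm_eq[OF q'(2)] 1 by simp_all
  note spec = qsym4_spec[of q "int p", OF q(1) _ _ \<alpha> gauss_fermat_1[OF p(1) 1 gq q(2) N, folded \<alpha>_def] this(1)]
    qsym4_spec[of "cnj q" "int p", OF gauss_prime_if_norm_prime[OF p(1) q'] _ _ \<alpha> gauss_fermat_1[OF p(1) 1 q' N, folded \<alpha>_def] this(2)]
  have s: "qsym4 \<alpha> q \<in> {1, \<i>, -1, -\<i>}" "gcong (\<alpha> ^ m) (qsym4 \<alpha> q) q"
      "qsym4 \<alpha> (cnj q) \<in> {1, \<i>, -1, -\<i>}" "gcong (\<alpha> ^ m) (qsym4 \<alpha> (cnj q)) (cnj q)"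
    using spec p(2) q(2) q'(2) by (simp_all del: insert_iff)
  define w where "w = qsym4 \<alpha> (cnj q)"
  have "w * cnj w = 1" using s(3) by (auto simp: w_def)
  then have v: "qsym4 \<alpha> q = \<i> ^ r * cnj w"
    using sym' by (metis w_def mult.assoc mult_1_right)
  \<comment> \<open>Conjugation carries the second factor of the symbol from the modulus
    \<open>cnj q\<close> to \<open>q\<close>; since w is a unit of absolute value 1, its inverse is
    \<open>cnj w\<close>, and the two factors combine to i^r.\<close>
  have "gcong (cnj \<alpha> ^ m) (cnj w) q"
    using gcong_cnj[of "\<alpha> ^ m" w "cnj q"] s(4) by (simp add: w_def)
  from gcong_mult_left[OF this, of "\<i> ^ r"] have "gcong (\<i> ^ r * cnj \<alpha> ^ m) (qsym4 \<alpha> q) q"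
    by (simp add: v)
  with s(2) have "gcong (\<alpha> ^ m) (\<i> ^ r * cnj \<alpha> ^ m) q" using gcong_sym gcong_trans by blast
  moreover have "half_power p \<alpha> = \<alpha> ^ m"
  proof -
    have "p mod 4 = 1" "(p + 1) div 4 = m" using 1 by auto
    then show ?thesis by (simp add: half_power_def)
  qed
  ultimately show ?thesis
    using that[of q] gdvd_of_int_iff_of_norm[OF p(1) gq q(2)] by simp
next
  case (2 m)
  have \<alpha>: "gauss_int \<alpha>" by (simp add: \<alpha>_def)
  have gp: "gauss_prime (of_nat p)" using gauss_prime_3_mod_4[OF p(1) 2] .
  have "gnorm (of_nat p) = p * p" by (rule gnorm_eq) simp
  \<comment> \<open>As p + 1 = 4 (m + 1), this is (p^2 - 1)/4, the exponent of the symbol for norm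
    p^2. Adding m + 1 gives p (m + 1), an exponent on which Frobenius acts.\<close>
  define k where "k = (p - 1) * Suc m"
  have k4: "4 * k = (p + 1) * (p - 1)" using 2 by (simp add: k_def algebra_simps)
  also have "\<dots> = p * p - 1" by (simp add: algebra_simps)
  finally have k: "k = (gnorm (of_nat p) - 1) div 4" using \<open>gnorm (of_nat p) = p * p\<close> by simp
  have "gcong (\<alpha> ^ (4 * k)) 1 (of_nat p)"
    unfolding k4 \<alpha>_def by (rule gauss_fermat_3[OF p(1) 2 N])
  then have "gcong (\<alpha> ^ k) (qsym4 \<alpha> (of_nat p)) (of_nat p)"
    using qsym4_spec(2)[of "of_nat p" "int p * int p", OF gp _ _ \<alpha> _ k] p(2) by simp
  then have "gcong (\<alpha> ^ k) (\<i> ^ r) (of_nat p)"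
    using sym gp by (simp add: qsym4_p_def)
  from gcong_mult_left[OF this, of "\<alpha> ^ Suc m"]
  have "gcong (\<alpha> ^ (Suc m + k)) (\<i> ^ r * \<alpha> ^ Suc m) (of_nat p)"
    using \<alpha> by (simp add: power_add mult_ac)
  moreover have "Suc m + k = p * Suc m" using 2 by (simp add: k_def algebra_simps)
  moreover have "gcong ((\<alpha> ^ p) ^ Suc m) (cnj \<alpha> ^ Suc m) (of_nat p)"
    using \<alpha> unfolding \<alpha>_def by (intro gcong_power gauss_frobenius_3[OF p(1) 2]) auto
  ultimately have "gcong (cnj \<alpha> ^ Suc m) (\<i> ^ r * \<alpha> ^ Suc m) (of_nat p)"
    using gcong_sym gcong_trans by (metis power_mult)
  moreover have "half_power p \<alpha> = cnj \<alpha> ^ Suc m"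
  proof -
    have "p mod 4 = 3" "(p + 1) div 4 = Suc m" using 2 by auto
    then show ?thesis by (simp add: half_power_def)
  qed
  ultimately show ?thesis
    using that[of "of_nat p"] gdvd_of_int_iff[of "int p"] by simp
qed

section \<open>Evaluation of the binomial sums from the quartic symbol\<close>

lemma gcong_of_int_iff: "gcong (of_int a) (of_int b) (of_int m) \<longleftrightarrow> [a = b] (mod m)"
  using gdvd_of_int_iff[of m "a - b"] by (simp add: gcong_def cong_iff_dvd_diff)

text \<open>The expansion yields h^2 \<alpha> minus its conjugate, where h is
  \<open>half_power p \<alpha>\<close>. The symbol relation h == u \<open>cnj h\<close> with u = i^r
  replaces h^2 by u times h \<open>cnj h\<close>, a rational integer, so imaginary parts of u
  \<alpha> remain. With real and imaginary part exchanged the difference becomes a sum and real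
  parts remain.\<close>

lemma even_binomial_sum_cong:
  fixes x y s t :: int
  assumes p: "prime p" "odd p" and N_def: "N = x\<^sup>2 + y\<^sup>2" and N: "\<not> int p dvd N"
    and sym: "qsym4_p (of_int x + of_int y * \<i>) p = \<i> ^ r"
    and st: "\<i> ^ r * (of_int x + of_int y * \<i>) = of_int s + of_int t * \<i>"
  defines "n \<equiv> (p - 1) div 2" and "m \<equiv> p div 4"
  shows "[2 ^ n * even_binomial_sum n x N * y = t * N ^ m] (mod int p)" (is ?A)
    and "[x * even_binomial_sum n y N = s * N ^ m] (mod int p)" (is ?B)
proof -
  define \<alpha> where "\<alpha> = of_int x + of_int y * \<i>"
  define u where "u = \<i> ^ r"
  define h where "h = half_power p \<alpha>"
  define K where "K = norm_factor p N"
  define W where "W = N ^ m * K"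
  have N0: "x\<^sup>2 + y\<^sup>2 \<noteq> 0" "y\<^sup>2 + x\<^sup>2 \<noteq> 0" using N by (auto simp: N_def)
  have \<alpha>: "gauss_int \<alpha>" by (simp add: \<alpha>_def)
  have norm: "\<alpha> * cnj \<alpha> = of_int N"
    unfolding \<alpha>_def N_def by (rule mult_cnj_of_int_plus_ii)
  have gh: "gauss_int h" using \<alpha> by (simp add: h_def)
  have hW: "h * cnj h = of_int W"
    unfolding h_def W_def K_def m_def by (rule half_power_mult_cnj[OF p(2) norm])
  have uu: "cnj u * u = 1" by (simp add: u_def flip: power_mult_distrib)
  have gu: "gauss_int u" by (simp add: u_def)
  obtain q where dvd_iff: "\<And>z. gdvd q (of_int z) \<longleftrightarrow> int p dvd z"
    and hq: "gcong h (u * cnj h) q"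
    using half_power_gcong_if_qsym4_p_eq[OF p N[unfolded N_def] sym] unfolding h_def \<alpha>_def u_def
    by blast
  have qp: "gdvd q (of_nat p)" using dvd_iff[of "int p"] by simp
  have cong_iff: "gcong (of_int a) (of_int b) q \<longleftrightarrow> [a = b] (mod int p)" for a b
    using dvd_iff[of "a - b"] by (simp add: gcong_def cong_iff_dvd_diff)
  \<comment> \<open>Conjugating \<open>hq\<close> would change the modulus to \<open>cnj q\<close>;
    multiplying by the inverse unit \<open>cnj u\<close> keeps it.\<close>
  have hq': "gcong (cnj h) (cnj u * h) q"
  proof -
    have "gcong (cnj u * h) (cnj u * (u * cnj h)) q" using hq gu by (intro gcong_mult_left) simp_all
    moreover have "cnj u * (u * cnj h) = cnj h" using uu by (metis mult.assoc mult_1_left)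
    ultimately show ?thesis by (simp add: gcong_sym)
  qed
  have 1: "gcong (h\<^sup>2 * \<alpha>) (of_int W * (u * \<alpha>)) q"
  proof -
    have "gcong (h * \<alpha> * h) (h * \<alpha> * (u * cnj h)) q" using hq gh \<alpha> by (intro gcong_mult_left) simp_all
    moreover have "h * \<alpha> * h = h\<^sup>2 * \<alpha>" "h * \<alpha> * (u * cnj h) = of_int W * (u * \<alpha>)"
      by (simp_all add: power2_eq_square hW[symmetric])
    ultimately show ?thesis by simp
  qed
  have 2: "gcong ((cnj h)\<^sup>2 * cnj \<alpha>) (of_int W * cnj (u * \<alpha>)) q"
  proof -
    have "gcong (cnj h * cnj \<alpha> * cnj h) (cnj h * cnj \<alpha> * (cnj u * h)) q"
      using hq' gh \<alpha> by (intro gcong_mult_left) simp_all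
    moreover have "cnj h * cnj \<alpha> * cnj h = (cnj h)\<^sup>2 * cnj \<alpha>"
        "cnj h * cnj \<alpha> * (cnj u * h) = of_int W * cnj (u * \<alpha>)"
      by (simp_all add: power2_eq_square hW[symmetric])
    ultimately show ?thesis by simp
  qed
  have pp: "prime (int p)" using p(1) by simp
  have cop2: "coprime 2 (int p)" using p(2) by simp
  have "coprime N (int p)" using N pp by (metis coprime_commute prime_imp_coprime)
  then have copK: "coprime K (int p)" by (simp add: K_def norm_factor_def)
  have u\<alpha>: "u * \<alpha> = of_int s + of_int t * \<i>" using st by (simp add: u_def \<alpha>_def)

  have "gcong (of_int (2 ^ n * even_binomial_sum n x N * K) * (\<alpha> - cnj \<alpha>))
      (h\<^sup>2 * \<alpha> - (cnj h)\<^sup>2 * cnj \<alpha>) q"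
    using gcong_modulus[OF even_binomial_sum_gcong[OF p N0(1)] qp]
    unfolding n_def K_def N_def h_def \<alpha>_def .
  \<comment> \<open>A difference of conjugates is 2i times an imaginary part; the factor -i makes
    both sides rational integers, so the congruence descends to p.\<close>
  from gcong_trans[OF this gcong_diff[OF 1 2]]
  have "gcong (- \<i> * (of_int (2 ^ n * even_binomial_sum n x N * K) * (\<alpha> - cnj \<alpha>)))
      (- \<i> * (of_int W * (u * \<alpha>) - of_int W * cnj (u * \<alpha>))) q"
    by (rule gcong_mult_left) simp
  moreover have "- \<i> * (of_int (2 ^ n * even_binomial_sum n x N * K) * (\<alpha> - cnj \<alpha>)) =
      of_int (2 * K * (2 ^ n * even_binomial_sum n x N * y))"
    by (simp add: \<alpha>_def algebra_simps)
  moreover have "- \<i> * (of_int W * (u * \<alpha>) - of_int W * cnj (u * \<alpha>)) = of_int (2 * K * (t * N ^ m))"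
    unfolding u\<alpha> by (simp add: W_def algebra_simps)
  ultimately have "[2 * K * (2 ^ n * even_binomial_sum n x N * y) = 2 * K * (t * N ^ m)] (mod int p)"
    by (simp only: cong_iff)
  moreover have "coprime (2 * K) (int p)" using cop2 copK by simp
  ultimately show ?A by (simp only: cong_mult_lcancel)

  define \<epsilon> :: int where "\<epsilon> = (- 1) ^ ((p + 1) div 4)"
  have "gcong (of_int (2 ^ n * 2)) (of_int (\<epsilon> * 2)) (of_int (int p))"
    using two_power_gcong[OF p] by (simp add: n_def \<epsilon>_def)
  then have two: "[2 ^ n * 2 = \<epsilon> * 2] (mod int p)" by (simp only: gcong_of_int_iff)
  \<comment> \<open>The sum with y in place of x belongs to this element of the same norm. Its
    squared half power differs from that of the conjugate of \<alpha> only by the sign \<epsilon>,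
    which \<open>two\<close> cancels against 2^n.\<close>
  define \<alpha>' where "\<alpha>' = of_int y + of_int x * \<i>"
  have \<alpha>': "\<alpha>' = \<i> * cnj \<alpha>" by (simp add: \<alpha>'_def \<alpha>_def algebra_simps)
  have h': "(half_power p \<alpha>')\<^sup>2 = of_int \<epsilon> * (cnj h)\<^sup>2"
    unfolding \<alpha>' \<epsilon>_def h_def by (simp add: half_power_ii_mult_cnj)
  have "(cnj (half_power p \<alpha>'))\<^sup>2 = cnj ((half_power p \<alpha>')\<^sup>2)" by simp
  then have h'': "(cnj (half_power p \<alpha>'))\<^sup>2 = of_int \<epsilon> * h\<^sup>2" by (simp only: h') simp
  have "gcong (of_int (2 ^ n * even_binomial_sum n y N * K) * (\<alpha>' - cnj \<alpha>'))
      ((half_power p \<alpha>')\<^sup>2 * \<alpha>' - (cnj (half_power p \<alpha>'))\<^sup>2 * cnj \<alpha>') q"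
    using gcong_modulus[OF even_binomial_sum_gcong[OF p N0(2)] qp]
    unfolding n_def K_def N_def \<alpha>'_def add.commute[of "x\<^sup>2"] .
  then have "gcong (- \<i> * (of_int (2 ^ n * even_binomial_sum n y N * K) * (\<alpha>' - cnj \<alpha>')))
      (- \<i> * ((half_power p \<alpha>')\<^sup>2 * \<alpha>' - (cnj (half_power p \<alpha>'))\<^sup>2 * cnj \<alpha>')) q"
    by (rule gcong_mult_left) simp
  moreover have "- \<i> * (of_int (2 ^ n * even_binomial_sum n y N * K) * (\<alpha>' - cnj \<alpha>')) =
      of_int (2 ^ n * 2 * K * (x * even_binomial_sum n y N))"
    by (simp add: \<alpha>'_def algebra_simps)
  moreover have "- \<i> * ((half_power p \<alpha>')\<^sup>2 * \<alpha>' - (cnj (half_power p \<alpha>'))\<^sup>2 * cnj \<alpha>') =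
      of_int \<epsilon> * (h\<^sup>2 * \<alpha> + (cnj h)\<^sup>2 * cnj \<alpha>)"
    unfolding h' h'' by (simp add: \<alpha>' algebra_simps)
  moreover have "gcong (of_int \<epsilon> * (h\<^sup>2 * \<alpha> + (cnj h)\<^sup>2 * cnj \<alpha>))
      (of_int \<epsilon> * (of_int W * (u * \<alpha>) + of_int W * cnj (u * \<alpha>))) q"
    by (intro gcong_mult_left gcong_add 1 2) simp
  moreover have "of_int \<epsilon> * (of_int W * (u * \<alpha>) + of_int W * cnj (u * \<alpha>)) =
      of_int (\<epsilon> * 2 * (K * (s * N ^ m)))"
    unfolding u\<alpha> by (simp add: W_def algebra_simps)
  ultimately have "gcong (of_int (2 ^ n * 2 * K * (x * even_binomial_sum n y N)))
      (of_int (\<epsilon> * 2 * (K * (s * N ^ m)))) q"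
    by (simp only:) (rule gcong_trans)
  then have "[2 ^ n * 2 * K * (x * even_binomial_sum n y N) = \<epsilon> * 2 * (K * (s * N ^ m))] (mod int p)"
    by (simp only: cong_iff)
  also have "[\<epsilon> * 2 * (K * (s * N ^ m)) = 2 ^ n * 2 * (K * (s * N ^ m))] (mod int p)"
    by (rule cong_scalar_right[OF cong_sym[OF two]])
  also have "2 ^ n * 2 * (K * (s * N ^ m)) = 2 ^ n * 2 * K * (s * N ^ m)" by simp
  finally have "[2 ^ n * 2 * K * (x * even_binomial_sum n y N) = 2 ^ n * 2 * K * (s * N ^ m)] (mod int p)" .
  moreover have "coprime (2 ^ n * 2 * K) (int p)" using cop2 copK by simp
  ultimately show ?B by (simp only: cong_mult_lcancel)
qed

section \<open>The localization of the integers at p\<close>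

text \<open>Frees membership from the reduced fraction of \<open>quotient_of\<close>: reducing a
  fraction cannot introduce a factor p into its denominator.\<close>

lemma in_Zp_iff:
  assumes "prime p"
  shows "in_Zp p x \<longleftrightarrow> (\<exists>a d. \<not> int p dvd d \<and> x = of_int a / of_int d)"
proof
  assume "in_Zp p x"
  then show "\<exists>a d. \<not> int p dvd d \<and> x = of_int a / of_int d"
    unfolding in_Zp_def by (metis prod.collapse quotient_of_div)
next
  assume "\<exists>a d. \<not> int p dvd d \<and> x = of_int a / of_int d"
  then obtain a d where d: "\<not> int p dvd d" and x: "x = of_int a / of_int d" by blast
  obtain a' d' where q: "quotient_of x = (a', d')" by fastforce
  then have d': "d' > 0" "coprime a' d'" and x': "x = of_int a' / of_int d'"
    by (auto dest: quotient_of_denom_pos quotient_of_coprime quotient_of_div)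
  have "d \<noteq> 0" using d by auto
  then have "of_int (a' * d) = (of_int (a * d') :: rat)"
    using x x' d'(1) by (simp add: field_simps)
  then have eq: "a' * d = a * d'" by (simp only: of_int_eq_iff)
  have pp: "prime (int p)" using assms by simp
  have "\<not> int p dvd d'"
  proof
    assume "int p dvd d'"
    moreover from this have "int p dvd a' * d" by (simp add: eq)
    then have "int p dvd a'" using d pp by (simp add: prime_dvd_mult_iff)
    ultimately have "is_unit (int p)" using coprime_common_divisor[OF d'(2)] by blast
    then show False using pp by auto
  qed
  then show "in_Zp p x" by (simp add: in_Zp_def q)
qed

context
  fixes p :: nat
  assumes p: "prime p"
begin

lemma in_Zp_of_int [simp]: "in_Zp p (of_int a)"
  using p unfolding in_Zp_def by (auto simp: prime_gt_1_nat)

lemma in_Zp_numeral [simp]: "in_Zp p (numeral k)" "in_Zp p 1" "in_Zp p 0" "in_Zp p (of_nat n)"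
  using in_Zp_of_int[of "numeral k"] in_Zp_of_int[of 1] in_Zp_of_int[of 0] in_Zp_of_int[of "int n"]
  by simp_all

lemma in_Zp_mult [simp]:
  assumes "in_Zp p x" "in_Zp p y"
  shows "in_Zp p (x * y)"
proof -
  obtain a d b e where "\<not> int p dvd d" "x = of_int a / of_int d" "\<not> int p dvd e" "y = of_int b / of_int e"
    using assms unfolding in_Zp_iff[OF p] by blast
  moreover from this have "\<not> int p dvd d * e" using p by (simp add: prime_dvd_mult_iff)
  moreover have "of_int a / of_int d * (of_int b / of_int e) = (of_int (a * b) / of_int (d * e) :: rat)" by simp
  ultimately show ?thesis unfolding in_Zp_iff[OF p] by metis
qed

lemma in_Zp_add [simp]:
  assumes "in_Zp p x" "in_Zp p y"
  shows "in_Zp p (x + y)"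
proof -
  obtain a d b e where *: "\<not> int p dvd d" "x = of_int a / of_int d" "\<not> int p dvd e" "y = of_int b / of_int e"
    using assms unfolding in_Zp_iff[OF p] by blast
  moreover from this have "\<not> int p dvd d * e" using p by (simp add: prime_dvd_mult_iff)
  moreover have "d \<noteq> 0" "e \<noteq> 0" using * by auto
  then have "of_int a / of_int d + of_int b / of_int e = (of_int (a * e + b * d) / of_int (d * e) :: rat)"
    by (simp add: field_simps)
  ultimately show ?thesis unfolding in_Zp_iff[OF p] by metis
qed

lemma in_Zp_minus [simp]: "in_Zp p x \<Longrightarrow> in_Zp p (- x)"
  using in_Zp_mult[of "of_int (- 1)" x] in_Zp_of_int[of "- 1"] by simp

lemma in_Zp_power [simp]: "in_Zp p x \<Longrightarrow> in_Zp p (x ^ n)"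
  by (induction n) auto

lemma zp_cong_refl [simp]: "zp_cong p x x"
  by (simp add: zp_cong_def)

lemma zp_cong_sym: "zp_cong p x y \<Longrightarrow> zp_cong p y x"
  unfolding zp_cong_def using in_Zp_minus[of "(x - y) / of_nat p"] by (simp add: minus_divide_left)

lemma zp_cong_add: "zp_cong p x y \<Longrightarrow> zp_cong p z w \<Longrightarrow> zp_cong p (x + z) (y + w)"
  unfolding zp_cong_def using in_Zp_add[of "(x - y) / of_nat p" "(z - w) / of_nat p"]
  by (simp add: add_divide_distrib[symmetric] algebra_simps)

lemma zp_cong_trans [trans]: "zp_cong p x y \<Longrightarrow> zp_cong p y z \<Longrightarrow> zp_cong p x z"
  using zp_cong_add[of x y y z] unfolding zp_cong_def by (simp add: algebra_simps)

lemma zp_cong_mult_left: "zp_cong p x y \<Longrightarrow> in_Zp p z \<Longrightarrow> zp_cong p (z * x) (z * y)"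
  unfolding zp_cong_def using in_Zp_mult[of z "(x - y) / of_nat p"] by (simp add: algebra_simps)

lemma zp_cong_mult:
  assumes "zp_cong p x y" "zp_cong p z w" "in_Zp p z" "in_Zp p y"
  shows "zp_cong p (x * z) (y * w)"
  using zp_cong_trans[OF zp_cong_mult_left[OF assms(1,3)], of "y * w"] zp_cong_mult_left[OF assms(2,4)]
  by (simp add: mult.commute)

lemma zp_cong_power:
  assumes "zp_cong p x y" "in_Zp p x" "in_Zp p y"
  shows "zp_cong p (x ^ n) (y ^ n)"
  by (induction n) (use assms in \<open>auto intro!: zp_cong_mult\<close>)

lemma zp_cong_sum: "(\<And>i. i \<in> A \<Longrightarrow> zp_cong p (f i) (g i)) \<Longrightarrow> zp_cong p (sum f A) (sum g A)"
  by (induction A rule: infinite_finite_induct) (auto intro!: zp_cong_add)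

lemma zp_cong_of_int: "[a = b] (mod int p) \<Longrightarrow> zp_cong p (of_int a) (of_int b)"
proof -
  assume "[a = b] (mod int p)"
  then obtain k where "a - b = int p * k" by (auto simp: cong_iff_dvd_diff)
  then have "of_int a - of_int b = (of_nat p * of_int k :: rat)"
    by (metis of_int_diff of_int_mult of_int_of_nat_eq)
  moreover have "p \<noteq> 0" using p by auto
  ultimately show ?thesis by (simp add: zp_cong_def)
qed

lemma in_Zp_inverse:
  assumes "in_Zp p x" "\<not> zp_cong p x 0"
  shows "in_Zp p (1 / x)"
proof -
  obtain a d where d: "\<not> int p dvd d" "x = of_int a / of_int d"
    using assms(1) unfolding in_Zp_iff[OF p] by blast
  have "\<not> int p dvd a"
  proof
    assume "int p dvd a"
    then obtain k where "a = int p * k" by auto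
    moreover have "p \<noteq> 0" using p by auto
    ultimately have "(x - 0) / of_nat p = of_int k / of_int d" using d by simp
    then have "in_Zp p ((x - 0) / of_nat p)" using d(1) unfolding in_Zp_iff[OF p] by blast
    then show False using assms(2) unfolding zp_cong_def by blast
  qed
  moreover have "1 / x = of_int d / of_int a" using d by simp
  ultimately show ?thesis unfolding in_Zp_iff[OF p] by blast
qed

lemma zp_cong_cancel_left:
  assumes "zp_cong p (z * x) (z * y)" "in_Zp p z" "\<not> zp_cong p z 0"
  shows "zp_cong p x y"
proof -
  have "z \<noteq> 0" using assms(3) by auto
  then show ?thesis
    using zp_cong_mult_left[OF assms(1) in_Zp_inverse[OF assms(2,3)]] by simp
qed

lemma zp_cong_mult_0_iff:
  assumes "in_Zp p x" "in_Zp p y"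
  shows "zp_cong p (x * y) 0 \<longleftrightarrow> zp_cong p x 0 \<or> zp_cong p y 0"
  using zp_cong_cancel_left[of x y 0] zp_cong_mult_left[of y 0 x] zp_cong_mult_left[of x 0 y] assms
  by (auto simp: mult.commute)

lemma zp_cong_power_0D:
  assumes "in_Zp p x" "zp_cong p (x ^ n) 0"
  shows "zp_cong p x 0"
  using assms(2)
proof (induction n)
  case 0
  \<comment> \<open>For exponent 0 the hypothesis reads 1 == 0, which fails because 1/p is not
    p-integral.\<close>
  have "\<not> in_Zp p (1 / of_nat p)"
  proof
    assume "in_Zp p (1 / of_nat p)"
    then obtain a d where d: "\<not> int p dvd d" "(1 :: rat) / of_nat p = of_int a / of_int d"
      unfolding in_Zp_iff[OF p] by blast
    moreover have "p \<noteq> 0" "d \<noteq> 0" using p d(1) by auto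
    ultimately have "of_int d = (of_int (a * int p) :: rat)" by (simp add: field_simps)
    then have "d = a * int p" by (simp only: of_int_eq_iff)
    then show False using d(1) by simp
  qed
  then show ?case using 0 by (simp add: zp_cong_def)
qed (use assms(1) in \<open>auto simp: zp_cong_mult_0_iff\<close>)

lemma zp_cong_of_int_0_iff: "zp_cong p (of_int a) 0 \<longleftrightarrow> int p dvd a"
proof
  assume "zp_cong p (of_int a) 0"
  then obtain b d where d: "\<not> int p dvd d" "of_int a / of_nat p = (of_int b / of_int d :: rat)"
    unfolding zp_cong_def diff_0_right in_Zp_iff[OF p] by blast
  moreover have "p \<noteq> 0" "d \<noteq> 0" using p d(1) by auto
  ultimately have "of_int (a * d) = (of_int (b * int p) :: rat)" by (simp add: field_simps)
  then have "a * d = b * int p" by (simp only: of_int_eq_iff)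
  then have "int p dvd a * d" by simp
  then show "int p dvd a" using d(1) p by (simp add: prime_dvd_mult_iff)
next
  assume "int p dvd a"
  then show "zp_cong p (of_int a) 0" using zp_cong_of_int[of a 0] by (simp add: cong_0_iff)
qed

lemma ex_int_zp_cong:
  assumes "in_Zp p x"
  shows "\<exists>a. zp_cong p (of_int a) x"
proof -
  obtain a d where d: "\<not> int p dvd d" "x = of_int a / of_int d"
    using assms unfolding in_Zp_iff[OF p] by blast
  then have "coprime d (int p)" using p by (metis coprime_commute prime_imp_coprime prime_nat_int_transfer)
  then obtain e where e: "[d * e = 1] (mod int p)" using cong_solve_coprime_int by blast
  have "[d * (a * e) = a] (mod int p)" using cong_scalar_left[OF e, of a] by (simp add: mult_ac)
  then have "zp_cong p (of_int (d * (a * e))) (of_int a)" by (rule zp_cong_of_int)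
  moreover have "of_int a = of_int d * x" using d by auto
  ultimately have "zp_cong p (of_int d * of_int (a * e)) (of_int d * x)" by simp
  then have "zp_cong p (of_int (a * e)) x"
    by (rule zp_cong_cancel_left) (simp_all add: zp_cong_of_int_0_iff d(1))
  then show ?thesis by blast
qed

text \<open>Exposes the very pair chosen by \<open>SOME\<close> in \<open>qsym4_Zp\<close>. Even for
  y = 1 the integer b is known only up to congruence.\<close>

lemma qsym4_Zp_witness:
  assumes "in_Zp p x" "in_Zp p y"
  obtains a b where "zp_cong p (of_int a) x" "zp_cong p (of_int b) y"
    "qsym4_Zp p x y = qsym4_p (of_int a + of_int b * \<i>) p"
proof -
  define ab where "ab = (SOME (a, b). zp_cong p (of_int a) x \<and> zp_cong p (of_int b) y)"
  have "\<exists>ab. (case ab of (a, b) \<Rightarrow> zp_cong p (of_int a) x \<and> zp_cong p (of_int b) y)"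
    using ex_int_zp_cong[OF assms(1)] ex_int_zp_cong[OF assms(2)] by auto
  then have "case ab of (a, b) \<Rightarrow> zp_cong p (of_int a) x \<and> zp_cong p (of_int b) y"
    unfolding ab_def by (rule someI_ex)
  moreover have "qsym4_Zp p x y = (let (a, b) = ab in qsym4_p (of_int a + of_int b * \<i>) p)"
    by (simp only: qsym4_Zp_def ab_def)
  ultimately show ?thesis using that by (cases ab) auto
qed

text \<open>The factor (16 D)^m clears every denominator. With C(4k, 2k) == (-4)^(2k) C(n, 2k) =
  16^k C(n, 2k), the powers of 16 collect to 16^m. The cases z = c and z = 1 give the two sums of
  the theorem.\<close>

lemma sum_zp_cong_even_binomial_sum:
  assumes "odd p" and z: "in_Zp p z" "zp_cong p (of_int x) z"
    and D: "D \<noteq> 0" "in_Zp p D" "zp_cong p (of_int N) D"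
  defines "n \<equiv> (p - 1) div 2" and "m \<equiv> p div 4"
  shows "zp_cong p ((16 * D) ^ m * (\<Sum>k = 0..m. of_nat ((4 * k) choose (2 * k)) * (z\<^sup>2 / (16 * D)) ^ k))
    (of_int (16 ^ m * even_binomial_sum n x N))"
proof -
  have n: "p = 2 * n + 1" "n div 2 = m" using \<open>odd p\<close> by (auto simp: n_def m_def elim!: oddE)
  have "(16 * D) ^ m * (\<Sum>k = 0..m. of_nat ((4 * k) choose (2 * k)) * (z\<^sup>2 / (16 * D)) ^ k) =
      (\<Sum>k\<le>m. of_nat ((4 * k) choose (2 * k)) * z ^ (2 * k) * (16 * D) ^ (m - k))"
    unfolding sum_distrib_left atLeast0AtMost
  proof (rule sum.cong)
    fix k assume "k \<in> {..m}"
    then have "(16 * D) ^ m = (16 * D) ^ (m - k) * (16 * D) ^ k"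
      using power_add[of "16 * D" "m - k" k] by simp
    then show "(16 * D) ^ m * (of_nat ((4 * k) choose (2 * k)) * (z\<^sup>2 / (16 * D)) ^ k) =
        of_nat ((4 * k) choose (2 * k)) * z ^ (2 * k) * (16 * D) ^ (m - k)"
      using D(1) by (simp add: power_divide power_mult)
  qed simp
  moreover have "of_int (16 ^ m * even_binomial_sum n x N) =
      (\<Sum>k\<le>m. of_int (16 ^ k * int (n choose (2 * k))) * of_int x ^ (2 * k) * (16 * of_int N) ^ (m - k) :: rat)"
    unfolding even_binomial_sum_def n sum_distrib_left of_int_sum
  proof (rule sum.cong)
    fix k assume "k \<in> {..m}"
    then have "(16 :: rat) ^ m = 16 ^ k * 16 ^ (m - k)" by (simp flip: power_add)
    then show "of_int (16 ^ m * (int (n choose (2 * k)) * x ^ (2 * k) * N ^ (m - k))) =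
      (of_int (16 ^ k * int (n choose (2 * k))) * of_int x ^ (2 * k) * (16 * of_int N) ^ (m - k) :: rat)"
      by (simp add: power_mult_distrib)
  qed simp
  moreover have "zp_cong p (of_nat ((4 * k) choose (2 * k)) * z ^ (2 * k) * (16 * D) ^ (m - k))
      (of_int (16 ^ k * int (n choose (2 * k))) * of_int x ^ (2 * k) * (16 * of_int N) ^ (m - k))"
    if "k \<le> m" for k
  proof -
    have "[int ((2 * (2 * k)) choose (2 * k)) = (- 4) ^ (2 * k) * int (n choose (2 * k))] (mod int p)"
      using that n by (intro central_binomial_cong p) auto
    then have "[int ((4 * k) choose (2 * k)) = 16 ^ k * int (n choose (2 * k))] (mod int p)"
      by (simp add: power_mult)
    from zp_cong_of_int[OF this]
    have "zp_cong p (of_nat ((4 * k) choose (2 * k))) (of_int (16 ^ k * int (n choose (2 * k))))" by simp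
    then show ?thesis using z D
      by (intro zp_cong_mult zp_cong_power zp_cong_mult_left) (auto simp: zp_cong_sym)
  qed
  ultimately show ?thesis by (simp only:) (rule zp_cong_sum, simp)
qed

end

text \<open>Writing i^r = e + f i treats the four classes at once: the first value is the imaginary
  part of i^r (c + i), the second is its real part divided by c.\<close>

lemma Qr_sums_zp_cong:
  assumes p: "prime p" "odd p" and c: "in_Zp p c" "\<not> zp_cong p (c * (c\<^sup>2 + 1)) 0"
    and r: "c \<in> Qr r p" and ef: "\<i> ^ r = of_int e + of_int f * \<i>"
  shows "zp_cong p (of_int (Legendre 2 (int p)) *
      (\<Sum>k = 0..p div 4. of_nat ((4 * k) choose (2 * k)) * (c\<^sup>2 / (16 * (c\<^sup>2 + 1))) ^ k))
      (of_int e + of_int f * c)" (is "zp_cong p (_ * ?S1) _")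
    and "zp_cong p (\<Sum>k = 0..p div 4. of_nat ((4 * k) choose (2 * k)) / (16 * (c\<^sup>2 + 1)) ^ k)
      (of_int e - of_int f / c)" (is "zp_cong p ?S2 _")
proof -
  note [simp] = in_Zp_of_int[OF p(1)] in_Zp_numeral[OF p(1)] in_Zp_mult[OF p(1)] in_Zp_add[OF p(1)]
    in_Zp_minus[OF p(1)] in_Zp_power[OF p(1)] zp_cong_refl[OF p(1)] c(1)
  note trans [trans] = zp_cong_trans[OF p(1)] and sym = zp_cong_sym[OF p(1)]
    and mult = zp_cong_mult[OF p(1)] and mult_left = zp_cong_mult_left[OF p(1)]
    and add = zp_cong_add[OF p(1)] and power = zp_cong_power[OF p(1)]
    and cancel = zp_cong_cancel_left[OF p(1)] and of_int = zp_cong_of_int[OF p(1)]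
    and zero_iff = zp_cong_mult_0_iff[OF p(1)] and of_int_0_iff = zp_cong_of_int_0_iff[OF p(1)]
  obtain a b where a: "zp_cong p (of_int a) c" and b: "zp_cong p (of_int b) 1"
    and ab: "qsym4_Zp p c 1 = qsym4_p (of_int a + of_int b * \<i>) p"
    by (rule qsym4_Zp_witness[OF p(1), of c 1]) auto
  define D where "D = c\<^sup>2 + 1"
  define N where "N = a\<^sup>2 + b\<^sup>2"
  define n m where "n = (p - 1) div 2" and "m = p div 4"
  \<comment> \<open>Real and imaginary part of i^r (a + b i), to be compared with e c - f and e + f
    c.\<close>
  define s t where "s = e * a - f * b" and "t = e * b + f * a"
  have c0: "\<not> zp_cong p c 0" and D0: "\<not> zp_cong p D 0"
    using c(2) by (auto simp: zero_iff D_def)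
  then have "c \<noteq> 0" "D \<noteq> 0" by (auto simp: zp_cong_refl[OF p(1)])
  have [simp]: "in_Zp p D" by (simp add: D_def)
  have ND: "zp_cong p (of_int N) D"
    using add[OF power[OF a, of 2] power[OF b, of 2]] by (simp add: N_def D_def)
  have N: "\<not> int p dvd N"
    using D0 trans[OF sym[OF ND]] by (auto simp: of_int_0_iff[symmetric])
  have symbol: "qsym4_p (of_int a + of_int b * \<i>) p = \<i> ^ r"
    using r ab by (simp add: Qr_def)
  have st: "\<i> ^ r * (of_int a + of_int b * \<i>) = of_int s + of_int t * \<i>"
    by (simp add: ef s_def t_def algebra_simps)
  note E = even_binomial_sum_cong[OF p N_def N symbol st, folded n_def m_def]
  have p16: "\<not> zp_cong p 16 0"
  proof
    assume "zp_cong p 16 0"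
    then have "int p dvd 2 ^ 4" using of_int_0_iff[of 16] by simp
    then have "int p dvd 2" using p(1) by (meson prime_dvd_power prime_nat_int_transfer)
    then have "p dvd 2" by presburger
    then show False using p primes_dvd_imp_eq two_is_prime_nat by blast
  qed
  define Z where "Z = (16 * D) ^ m"
  have [simp]: "in_Zp p Z" by (simp add: Z_def)
  have Z0: "\<not> zp_cong p Z 0"
    using zp_cong_power_0D[OF p(1), of "16 * D" m] p16 D0 by (auto simp: Z_def zero_iff)
  have NZ: "zp_cong p (of_int (16 ^ m * N ^ m)) Z"
    using power[OF mult_left[OF ND, of 16], of m] by (simp add: Z_def power_mult_distrib)
  have sum1: "zp_cong p (Z * ?S1) (of_int (16 ^ m * even_binomial_sum n a N))"
    using sum_zp_cong_even_binomial_sum[OF p(1,2) c(1) a \<open>D \<noteq> 0\<close> _ ND]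
    by (simp add: Z_def D_def n_def m_def)
  have sum2: "zp_cong p (Z * ?S2) (of_int (16 ^ m * even_binomial_sum n b N))"
    using sum_zp_cong_even_binomial_sum[OF p(1,2) _ b \<open>D \<noteq> 0\<close> _ ND]
    by (simp add: Z_def D_def n_def m_def power_divide)

  have "2 < p" using p prime_ge_2_nat[of p] by (cases "p = 2") auto
  define L where "L = Legendre 2 (int p)"
  \<comment> \<open>The Legendre symbol enters only here, as the value of 2^n modulo p.\<close>
  have L: "[L = 2 ^ n] (mod int p)"
    unfolding L_def n_def m_def using euler_criterion[OF p(1) \<open>2 < p\<close>] .
  have t: "zp_cong p (of_int t) (of_int e + of_int f * c)"
    using add[OF mult_left[OF b, of "of_int e"] mult_left[OF a, of "of_int f"]] by (simp add: s_def t_def)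
  have s: "zp_cong p (of_int s) (of_int e * c - of_int f)"
    using add[OF mult_left[OF a, of "of_int e"] mult_left[OF b, of "- of_int f"]] by (simp add: s_def t_def)
  show "zp_cong p (of_int L * ?S1) (of_int e + of_int f * c)"
  proof (rule cancel)
    define X where "X = L * (16 ^ m * even_binomial_sum n a N)"
    have "zp_cong p (Z * (of_int L * ?S1)) (of_int X * 1)"
      using mult_left[OF sum1, of "of_int L"] by (simp add: X_def mult_ac)
    \<comment> \<open>The factor b == 1 is inserted because \<open>E(1)\<close> evaluates the sum
      only together with its factor y = b.\<close>
    also have "zp_cong p (of_int X * 1) (of_int X * of_int b)"
      by (rule mult_left[OF sym[OF b]]) simp
    also have "of_int X * of_int b = (of_int (X * b) :: rat)" by simp
    also have "zp_cong p (of_int (X * b)) (of_int (t * (16 ^ m * N ^ m)))"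
    proof (rule of_int)
      have "[L * (16 ^ m * even_binomial_sum n a N * b) = 2 ^ n * (16 ^ m * even_binomial_sum n a N * b)] (mod int p)"
        by (rule cong_scalar_right[OF L])
      moreover have "[16 ^ m * (2 ^ n * even_binomial_sum n a N * b) = 16 ^ m * (t * N ^ m)] (mod int p)"
        by (rule cong_scalar_left[OF E(1)])
      ultimately show "[X * b = t * (16 ^ m * N ^ m)] (mod int p)"
        by (simp add: X_def mult_ac) (metis cong_trans)
    qed
    also have "of_int (t * (16 ^ m * N ^ m)) = of_int t * (of_int (16 ^ m * N ^ m) :: rat)" by simp
    also have "zp_cong p (of_int t * of_int (16 ^ m * N ^ m)) ((of_int e + of_int f * c) * Z)"
      by (rule mult[OF t NZ]) auto
    also have "(of_int e + of_int f * c) * Z = Z * (of_int e + of_int f * c)" by simp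
    finally show "zp_cong p (Z * (of_int L * ?S1)) (Z * (of_int e + of_int f * c))" .
  qed (use Z0 in auto)
  show "zp_cong p ?S2 (of_int e - of_int f / c)"
  proof (rule cancel)
    define X where "X = 16 ^ m * even_binomial_sum n b N"
    have "zp_cong p (c * Z * ?S2) (c * of_int X)"
      using mult_left[OF sum2, of c] by (simp add: X_def mult_ac)
    \<comment> \<open>Multiplying by c at the start provides, after replacement by a, the factor x =
      a required by \<open>E(2)\<close>; it is also the source of the denominator c in the
      result.\<close>
    also have "zp_cong p (c * of_int X) (of_int a * of_int X)"
      using mult_left[OF sym[OF a], of "of_int X"] by (simp add: mult.commute)
    also have "of_int a * of_int X = (of_int (a * X) :: rat)" by simp
    also have "zp_cong p (of_int (a * X)) (of_int (s * (16 ^ m * N ^ m)))"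
      using cong_scalar_left[OF E(2), of "16 ^ m"] by (intro of_int) (simp add: X_def mult_ac)
    also have "of_int (s * (16 ^ m * N ^ m)) = of_int s * (of_int (16 ^ m * N ^ m) :: rat)" by simp
    also have "zp_cong p (of_int s * of_int (16 ^ m * N ^ m)) ((of_int e * c - of_int f) * Z)"
      by (rule mult[OF s NZ]) (auto simp: diff_conv_add_uminus simp del: add_uminus_conv_diff)
    also have "(of_int e * c - of_int f) * Z = c * Z * (of_int e - of_int f / c)"
      using \<open>c \<noteq> 0\<close> by (simp add: field_simps)
    finally show "zp_cong p (c * Z * ?S2) (c * Z * (of_int e - of_int f / c))" .
  qed (use Z0 c0 in \<open>auto simp: zero_iff\<close>)
qed

theorem theorem2p1:
  fixes p :: nat and c :: rat
  assumes "prime p" and "odd p" and "in_Zp p c"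
    and "\<not> zp_cong p (c * (c^2 + 1)) 0"
  defines "S1 \<equiv> (\<Sum>k = 0..p div 4. of_nat ((4*k) choose (2*k)) * (c^2 / (16 * (c^2 + 1))) ^ k)"
    and "S2 \<equiv> (\<Sum>k = 0..p div 4. of_nat ((4*k) choose (2*k)) / (16 * (c^2 + 1)) ^ k)"
  shows "(c \<in> Qr 0 p \<longrightarrow> zp_cong p (of_int (Legendre 2 (int p)) * S1) 1) \<and>
         (c \<in> Qr 1 p \<longrightarrow> zp_cong p (of_int (Legendre 2 (int p)) * S1) c) \<and>
         (c \<in> Qr 2 p \<longrightarrow> zp_cong p (of_int (Legendre 2 (int p)) * S1) (-1)) \<and>
         (c \<in> Qr 3 p \<longrightarrow> zp_cong p (of_int (Legendre 2 (int p)) * S1) (-c)) \<and>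
         (c \<in> Qr 0 p \<longrightarrow> zp_cong p S2 1) \<and>
         (c \<in> Qr 1 p \<longrightarrow> zp_cong p S2 (- 1 / c)) \<and>
         (c \<in> Qr 2 p \<longrightarrow> zp_cong p S2 (-1)) \<and>
         (c \<in> Qr 3 p \<longrightarrow> zp_cong p S2 (1 / c))"
proof -
  note sums = Qr_sums_zp_cong[OF assms(1-4), folded S1_def S2_def]
  show ?thesis
    \<comment> \<open>The coordinates (e, f) of 1, i, -1 and -i.\<close>
    using sums[of 0 1 0] sums[of 1 0 1] sums[of 2 "- 1" 0] sums[of 3 0 "- 1"]
    by (simp add: numeral_3_eq_3)
qed

end
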